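(* Let $\kappa$ be an arbitrary infinite cardinality, let $M$ be a set with $|M|=\kappa$, and let $(A_i)_{i\in M}$ be a family of lattices satisfying the descending chain condition (hence having smallest elements $0^{A_i}$) such that, for all $i\in M$, $|A_i|\leq\kappa$ and $\{\alpha\in{\rm Con}(A_i)\mid 0^{A_i}/\alpha=\{0^{A_i}\}\}=\{\Delta_{A_i}\}$. Let $P=\prod_{i\in M}A_i$, let $Q=P\amalg\{{\bf 1}\}$ be the bounded lattice obtained from $P$ by adding a new top element ${\bf 1}$, and let $S$ be the bounded sublattice $$S=\{(x_i)_{i\in M}\in P\mid |\{i\in M\mid x_i\neq 0^{A_i}\}|<\aleph_0\}\amalg\{{\bf 1}\}$$ of $Q$. Then $|S|=\kappa$, all filters of $S$ are principal, $|{\rm Filt}(S)|=\kappa$, $|{\rm Id}(S)|=2^{\kappa}$, and ${\rm Con}_{01}(S)=\{\Delta_S\}$. Moreover, if $H=S\boxplus{\cal L}_2^2$ is the horizontal sum of $S$ with the four-element Boolean lattice ${\cal L}_2^2$, then the bounded lattice $H$ is simple, $|{\rm Filt}(H)|=|{\rm Filt}(S)|=\kappa$ and $|{\rm Id}(H)|=|{\rm Id}(S)|=2^{\kappa}$. Hence $|{\rm Con}(H)|$, $|{\rm Filt}(H)|$ and $|{\rm Id}(H)|$ are pairwise distinct.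
   Context: For a lattice $L$, ${\rm Con}(L)$, ${\rm Filt}(L)$ and ${\rm Id}(L)$ are the sets of its congruences, of its (non-empty) filters and of its (non-empty) ideals; $\Delta_L$ is the equality relation on $L$, and $x/\alpha$ is the class of $x$ modulo $\alpha$. For a bounded lattice $L$, ${\rm Con}_{01}(L)$ is the set of the congruences $\theta$ of $L$ with $0/\theta=\{0\}$ and $1/\theta=\{1\}$. A lattice is simple if it has exactly two congruences. The symbol $\amalg$ denotes disjoint union. Horizontal sum: for bounded lattices $A$ and $B$ with at least two elements each, $A\boxplus B$ is the bounded lattice obtained from the disjoint union of $A$ and $B$ by identifying the two bottom elements and identifying the two top elements, ordered by the union of the orders of $A$ and $B$ (so elements of $A\setminus\{0,1\}$ and $B\setminus\{0,1\}$ are incomparable, with join $1$ and meet $0$). The Continuum Hypothesis is not assumed.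
   Formalization: The formal theorem additionally assumes that κ many of the lattices A_i have at least two elements; without this the claim fails, e.g. if all A_i are one-element lattices then |S|=2 and H is the four-element Boolean lattice, which is not simple. *)

theory Defs
  imports "HOL-Algebra.Lattice" "HOL-Library.FuncSet"
begin

unbundle cardinal_syntax

definition dcc :: "('a, 'm) gorder_scheme \<Rightarrow> bool" where
  "dcc L \<longleftrightarrow> \<not> (\<exists>f :: nat \<Rightarrow> 'a. \<forall>n. f n \<in> carrier L \<and> f (Suc n) \<sqsubset>\<^bsub>L\<^esub> f n)"

definition Con :: "('a, 'm) gorder_scheme \<Rightarrow> ('a \<times> 'a) set set" where
  "Con L = {\<theta>. equiv (carrier L) \<theta> \<and>
     (\<forall>x x' y y'. (x, x') \<in> \<theta> \<longrightarrow> (y, y') \<in> \<theta> \<longrightarrow>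
        (x \<squnion>\<^bsub>L\<^esub> y, x' \<squnion>\<^bsub>L\<^esub> y') \<in> \<theta> \<and> (x \<sqinter>\<^bsub>L\<^esub> y, x' \<sqinter>\<^bsub>L\<^esub> y') \<in> \<theta>)}"

definition Con01 :: "('a, 'm) gorder_scheme \<Rightarrow> ('a \<times> 'a) set set" where
  "Con01 L = {\<theta> \<in> Con L. \<theta> `` {\<bottom>\<^bsub>L\<^esub>} = {\<bottom>\<^bsub>L\<^esub>} \<and> \<theta> `` {\<top>\<^bsub>L\<^esub>} = {\<top>\<^bsub>L\<^esub>}}"

definition simple_lattice :: "('a, 'm) gorder_scheme \<Rightarrow> bool" where
  "simple_lattice L \<longleftrightarrow> lattice L \<and> card (Con L) = 2"

definition Filt :: "('a, 'm) gorder_scheme \<Rightarrow> 'a set set" where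
  "Filt L = {F. F \<subseteq> carrier L \<and> F \<noteq> {} \<and>
     (\<forall>x\<in>F. \<forall>y\<in>F. x \<sqinter>\<^bsub>L\<^esub> y \<in> F) \<and>
     (\<forall>x\<in>F. \<forall>y\<in>carrier L. x \<sqsubseteq>\<^bsub>L\<^esub> y \<longrightarrow> y \<in> F)}"

definition Idl :: "('a, 'm) gorder_scheme \<Rightarrow> 'a set set" where
  "Idl L = {I. I \<subseteq> carrier L \<and> I \<noteq> {} \<and>
     (\<forall>x\<in>I. \<forall>y\<in>I. x \<squnion>\<^bsub>L\<^esub> y \<in> I) \<and>
     (\<forall>x\<in>I. \<forall>y\<in>carrier L. y \<sqsubseteq>\<^bsub>L\<^esub> x \<longrightarrow> y \<in> I)}"

definition principal_filter :: "('a, 'm) gorder_scheme \<Rightarrow> 'a \<Rightarrow> 'a set" where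
  "principal_filter L a = {x \<in> carrier L. a \<sqsubseteq>\<^bsub>L\<^esub> x}"

definition bounded_sublattice :: "'a set \<Rightarrow> ('a, 'm) gorder_scheme \<Rightarrow> bool" where
  "bounded_sublattice B L \<longleftrightarrow> B \<subseteq> carrier L \<and> \<bottom>\<^bsub>L\<^esub> \<in> B \<and> \<top>\<^bsub>L\<^esub> \<in> B \<and>
     (\<forall>x\<in>B. \<forall>y\<in>B. x \<squnion>\<^bsub>L\<^esub> y \<in> B \<and> x \<sqinter>\<^bsub>L\<^esub> y \<in> B)"

definition prod_lattice :: "'i set \<Rightarrow> ('i \<Rightarrow> ('a, 'm) gorder_scheme) \<Rightarrow> ('i \<Rightarrow> 'a) gorder" where
  "prod_lattice M A = \<lparr>carrier = (\<Pi>\<^sub>E i\<in>M. carrier (A i)), eq = (=),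
     le = (\<lambda>x y. \<forall>i\<in>M. x i \<sqsubseteq>\<^bsub>A i\<^esub> y i)\<rparr>"

text \<open>The new top element is \<^const>\<open>None\<close>.\<close>

definition add_top :: "('a, 'm) gorder_scheme \<Rightarrow> 'a option gorder" where
  "add_top L = \<lparr>carrier = insert None (Some ` carrier L), eq = (=),
     le = (\<lambda>x y. y = None \<or> (\<exists>a b. x = Some a \<and> y = Some b \<and> a \<sqsubseteq>\<^bsub>L\<^esub> b))\<rparr>"

text \<open>The horizontal sum is built on the disjoint union, in which the bounds of the second
  summand are replaced by those of the first one; \<open>hsum_in2\<close> is the resulting
  inclusion of the second summand.\<close>

definition hsum_in2 ::
  "('a, 'm) gorder_scheme \<Rightarrow> ('b, 'n) gorder_scheme \<Rightarrow> 'b \<Rightarrow> 'a + 'b" where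
  "hsum_in2 A B b =
     (if b = \<bottom>\<^bsub>B\<^esub> then Inl \<bottom>\<^bsub>A\<^esub> else if b = \<top>\<^bsub>B\<^esub> then Inl \<top>\<^bsub>A\<^esub> else Inr b)"

definition hsum ::
  "('a, 'm) gorder_scheme \<Rightarrow> ('b, 'n) gorder_scheme \<Rightarrow> ('a + 'b) gorder" (infixl "\<boxplus>" 65) where
  "A \<boxplus> B = \<lparr>carrier = Inl ` carrier A \<union> hsum_in2 A B ` carrier B, eq = (=),
     le = (\<lambda>x y. (\<exists>a\<in>carrier A. \<exists>a'\<in>carrier A. x = Inl a \<and> y = Inl a' \<and> a \<sqsubseteq>\<^bsub>A\<^esub> a') \<or>
                 (\<exists>b\<in>carrier B. \<exists>b'\<in>carrier B.
                    x = hsum_in2 A B b \<and> y = hsum_in2 A B b' \<and> b \<sqsubseteq>\<^bsub>B\<^esub> b'))\<rparr>"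

definition L22 :: "(bool \<times> bool) gorder" where
  "L22 = \<lparr>carrier = UNIV, eq = (=), le = (\<lambda>x y. fst x \<le> fst y \<and> snd x \<le> snd y)\<rparr>"

end

theory Submission
  imports Defs "HOL-Algebra.Free_Abelian_Groups"
begin

text \<open>
  Filters of \<open>S\<close>.  By the descending chain condition, the values that the members of a filter take
  at a fixed index have a least one, and below a given member only finitely many indices matter.  A
  finite meet therefore attains all these least values, and every filter is principal
  (\<open>Filt_S_principal\<close>).  So \<open>S\<close> has as many filters as elements, and these are counted by finite
  subsets of the disjoint union of the factors.  Ideals need no finite generation: the families
  supported in a set \<open>X\<close> of indices form an ideal, and distinct sets of indices with nontrivial
  factors give distinct ideals (\<open>card_Idl_S\<close>).

  Congruences.  A congruence in \<open>Con01 S\<close> pulls back to each factor along its axis, where the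
  hypothesis on the factors forces equality; related families then agree in every coordinate
  (\<open>Con01_S\<close>).  In the horizontal sum with the four-element Boolean lattice, every element other
  than the bounds belongs to a triple of pairwise complementary elements.  Such a triple generates
  a simple five-element sublattice containing both bounds (\<open>M3_collapse\<close>), so a congruence that is
  not full has singleton classes at the bounds, restricts to a member of \<open>Con01 S\<close>, and is equality
  (\<open>simple_H\<close>).

  Adding two elements does not change the infinite numbers of filters and ideals
  (\<open>card_Filt_embedding\<close>, \<open>card_Idl_embedding\<close>), so \<open>H\<close> has \<open>2\<close>
  congruences, \<open>\<kappa>\<close> filters and \<open>2\<^sup>\<kappa>\<close> ideals.
\<close>

section \<open>Lattices presented by their operations\<close>

text \<open>The operations \<^const>\<open>join\<close> and \<^const>\<open>meet\<close> are choices of bounds.  The locale certifies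
  explicit formulas for them, which can be computed with; \<open>join_eq\<close> and \<open>meet_eq\<close> below
  lead back to the chosen bounds.\<close>

locale lattice_ops =
  fixes L :: "('a, 'm) gorder_scheme" (structure) and j m :: "'a \<Rightarrow> 'a \<Rightarrow> 'a"
  assumes eq: "(.=) = (=)"
    and refl: "x \<in> carrier L \<Longrightarrow> x \<sqsubseteq> x"
    and antisym: "\<lbrakk>x \<sqsubseteq> y; y \<sqsubseteq> x; x \<in> carrier L; y \<in> carrier L\<rbrakk> \<Longrightarrow> x = y"
    and trans: "\<lbrakk>x \<sqsubseteq> y; y \<sqsubseteq> z; x \<in> carrier L; y \<in> carrier L; z \<in> carrier L\<rbrakk> \<Longrightarrow> x \<sqsubseteq> z"
    and j_closed: "\<lbrakk>x \<in> carrier L; y \<in> carrier L\<rbrakk> \<Longrightarrow> j x y \<in> carrier L"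
    and j_left: "\<lbrakk>x \<in> carrier L; y \<in> carrier L\<rbrakk> \<Longrightarrow> x \<sqsubseteq> j x y"
    and j_right: "\<lbrakk>x \<in> carrier L; y \<in> carrier L\<rbrakk> \<Longrightarrow> y \<sqsubseteq> j x y"
    and j_least: "\<lbrakk>x \<sqsubseteq> z; y \<sqsubseteq> z; x \<in> carrier L; y \<in> carrier L; z \<in> carrier L\<rbrakk> \<Longrightarrow> j x y \<sqsubseteq> z"
    and m_closed: "\<lbrakk>x \<in> carrier L; y \<in> carrier L\<rbrakk> \<Longrightarrow> m x y \<in> carrier L"
    and m_left: "\<lbrakk>x \<in> carrier L; y \<in> carrier L\<rbrakk> \<Longrightarrow> m x y \<sqsubseteq> x"
    and m_right: "\<lbrakk>x \<in> carrier L; y \<in> carrier L\<rbrakk> \<Longrightarrow> m x y \<sqsubseteq> y"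
    and m_greatest: "\<lbrakk>z \<sqsubseteq> x; z \<sqsubseteq> y; x \<in> carrier L; y \<in> carrier L; z \<in> carrier L\<rbrakk> \<Longrightarrow> z \<sqsubseteq> m x y"
begin

lemma partial_order: "partial_order L"
  by unfold_locales (auto simp: eq refl intro: antisym trans)

lemma j_lub: "\<lbrakk>x \<in> carrier L; y \<in> carrier L\<rbrakk> \<Longrightarrow> least L (j x y) (Upper L {x, y})"
  by (auto simp: least_def Upper_def j_closed j_left j_right intro: j_least)

lemma m_glb: "\<lbrakk>x \<in> carrier L; y \<in> carrier L\<rbrakk> \<Longrightarrow> greatest L (m x y) (Lower L {x, y})"
  by (auto simp: greatest_def Lower_def m_closed m_left m_right intro: m_greatest)

lemma lattice: "lattice L"
proof -
  interpret partial_order L by (rule partial_order)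
  show ?thesis
    by unfold_locales (use j_lub m_glb in blast)+
qed

lemma join_eq: "\<lbrakk>x \<in> carrier L; y \<in> carrier L\<rbrakk> \<Longrightarrow> x \<squnion> y = j x y"
  unfolding join_def Lattice.sup_def
  by (rule some_equality, erule (1) j_lub)
    (rule partial_order.least_unique[OF partial_order _ j_lub])

lemma meet_eq: "\<lbrakk>x \<in> carrier L; y \<in> carrier L\<rbrakk> \<Longrightarrow> x \<sqinter> y = m x y"
  unfolding meet_def Lattice.inf_def
  by (rule some_equality, erule (1) m_glb)
    (rule partial_order.greatest_unique[OF partial_order _ m_glb])

lemma bottom_eq:
  assumes "b \<in> carrier L" "\<And>x. x \<in> carrier L \<Longrightarrow> b \<sqsubseteq> x"
  shows "\<bottom> = b"
  unfolding bottom_def using assms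
  by (intro some_equality) (auto simp: least_def intro: antisym)

lemma top_eq:
  assumes "t \<in> carrier L" "\<And>x. x \<in> carrier L \<Longrightarrow> x \<sqsubseteq> t"
  shows "\<top> = t"
  unfolding top_def using assms
  by (intro some_equality) (auto simp: greatest_def intro: antisym)

lemma bounded_latticeI:
  assumes "b \<in> carrier L" "\<And>x. x \<in> carrier L \<Longrightarrow> b \<sqsubseteq> x"
    and "t \<in> carrier L" "\<And>x. x \<in> carrier L \<Longrightarrow> x \<sqsubseteq> t"
  shows "bounded_lattice L"
proof -
  interpret lattice L by (rule lattice)
  show ?thesis
    by unfold_locales (use assms in \<open>auto simp: least_def greatest_def\<close>)
qed

lemma le_iff_m: "\<lbrakk>x \<in> carrier L; y \<in> carrier L\<rbrakk> \<Longrightarrow> x \<sqsubseteq> y \<longleftrightarrow> m x y = x"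
  by (metis antisym m_closed m_greatest m_left m_right refl)

lemma le_iff_j: "\<lbrakk>x \<in> carrier L; y \<in> carrier L\<rbrakk> \<Longrightarrow> x \<sqsubseteq> y \<longleftrightarrow> j x y = y"
  by (metis antisym j_closed j_least j_left j_right refl)

lemma idem: "x \<in> carrier L \<Longrightarrow> j x x = x" "x \<in> carrier L \<Longrightarrow> m x x = x"
  using le_iff_j le_iff_m refl by blast+

lemma m_mono:
  "\<lbrakk>a \<sqsubseteq> b; c \<sqsubseteq> d; a \<in> carrier L; b \<in> carrier L; c \<in> carrier L; d \<in> carrier L\<rbrakk>
    \<Longrightarrow> m a c \<sqsubseteq> m b d"
  by (meson m_closed m_greatest m_left m_right trans)

lemma sublattice:
  assumes "B \<subseteq> carrier L" "\<And>x y. \<lbrakk>x \<in> B; y \<in> B\<rbrakk> \<Longrightarrow> j x y \<in> B \<and> m x y \<in> B"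
  shows "lattice_ops (L\<lparr>carrier := B\<rparr>) j m"
proof -
  have c: "x \<in> carrier L" if "x \<in> B" for x
    using assms(1) that by blast
  show ?thesis
    by unfold_locales
      (use assms(2) in \<open>simp_all add: c eq refl antisym trans[OF _ _ c c c] j_left j_right j_least
        m_left m_right m_greatest\<close>)
qed

end

lemma lattice_ops_of_lattice:
  assumes "lattice L"
  shows "lattice_ops L (join L) (meet L)"
proof -
  interpret lattice L by (rule assms)
  show ?thesis
    by unfold_locales
      (auto simp: eq_is_equal join_left join_right meet_left meet_right
        intro: le_trans join_le meet_le)
qed

section \<open>Filters and ideals\<close>

lemma FiltI:
  assumes "F \<subseteq> carrier L" "a \<in> F"
    and "\<And>x y. \<lbrakk>x \<in> F; y \<in> F\<rbrakk> \<Longrightarrow> x \<sqinter>\<^bsub>L\<^esub> y \<in> F"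
    and "\<And>x y. \<lbrakk>x \<in> F; y \<in> carrier L; x \<sqsubseteq>\<^bsub>L\<^esub> y\<rbrakk> \<Longrightarrow> y \<in> F"
  shows "F \<in> Filt L"
  using assms unfolding Filt_def by blast

lemma FiltD:
  assumes "F \<in> Filt L"
  shows "F \<subseteq> carrier L" "F \<noteq> {}"
    and "\<And>x y. \<lbrakk>x \<in> F; y \<in> F\<rbrakk> \<Longrightarrow> x \<sqinter>\<^bsub>L\<^esub> y \<in> F"
    and "\<And>x y. \<lbrakk>x \<in> F; y \<in> carrier L; x \<sqsubseteq>\<^bsub>L\<^esub> y\<rbrakk> \<Longrightarrow> y \<in> F"
  using assms unfolding Filt_def by blast+

lemma Idl_dual: "Idl L = Filt (inv_gorder L)"
  by (simp add: Idl_def Filt_def)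

lemma card_Idl_le: "|Idl L| \<le>o |Pow (carrier L)|"
  by (rule card_of_mono1) (auto simp: Idl_def)

lemma card_Filt_if_all_principal:
  assumes "lattice L" and "\<forall>F\<in>Filt L. \<exists>a\<in>carrier L. F = principal_filter L a"
  shows "|Filt L| =o |carrier L|"
proof -
  interpret L: lattice_ops L "join L" "meet L"
    by (rule lattice_ops_of_lattice) (rule assms)
  have mem: "a \<in> principal_filter L a" if "a \<in> carrier L" for a
    using that by (simp add: principal_filter_def L.refl)
  have "a = b" if ab: "a \<in> carrier L" "b \<in> carrier L" "principal_filter L a = principal_filter L b"
    for a b
  proof -
    have "a \<in> principal_filter L b" "b \<in> principal_filter L a"
      using mem ab by metis+
    then show ?thesis
      unfolding principal_filter_def using ab(1,2) L.antisym by blast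
  qed
  then have "inj_on (principal_filter L) (carrier L)"
    by (rule inj_onI)
  moreover have "principal_filter L a \<in> Filt L" if a: "a \<in> carrier L" for a
  proof (rule FiltI)
    show "a \<in> principal_filter L a"
      using a by (rule mem)
    show "\<And>x y. \<lbrakk>x \<in> principal_filter L a; y \<in> carrier L; x \<sqsubseteq>\<^bsub>L\<^esub> y\<rbrakk> \<Longrightarrow> y \<in> principal_filter L a"
      unfolding principal_filter_def using a L.trans by blast
  qed (use a in \<open>auto simp: principal_filter_def L.m_closed L.m_greatest\<close>)
  then have "principal_filter L ` carrier L = Filt L"
    using assms(2) by blast
  ultimately have "bij_betw (principal_filter L) (carrier L) (Filt L)"
    by (simp add: bij_betw_def)
  then show ?thesis
    using card_of_ordIso ordIso_symmetric by blast
qed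

text \<open>A filter of the smaller lattice is recovered from the filter it generates in the larger
  one; a filter of the larger one is determined by its trace on the smaller one together with
  the elements outside, of which there are finitely many.\<close>

lemma card_Filt_embedding:
  assumes "lattice K" "lattice L"
    and f: "f \<in> carrier K \<rightarrow> carrier L"
    and emb: "\<And>x y. \<lbrakk>x \<in> carrier K; y \<in> carrier K\<rbrakk> \<Longrightarrow> f x \<sqsubseteq>\<^bsub>L\<^esub> f y \<longleftrightarrow> x \<sqsubseteq>\<^bsub>K\<^esub> y"
    and meet: "\<And>x y. \<lbrakk>x \<in> carrier K; y \<in> carrier K\<rbrakk> \<Longrightarrow> f (x \<sqinter>\<^bsub>K\<^esub> y) = f x \<sqinter>\<^bsub>L\<^esub> f y"
    and top: "t \<in> carrier K" "\<And>y. y \<in> carrier L \<Longrightarrow> y \<sqsubseteq>\<^bsub>L\<^esub> f t"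
    and fin: "finite (carrier L - f ` carrier K)" and inf: "infinite (Filt K)"
  shows "|Filt L| =o |Filt K|"
proof -
  interpret K: lattice_ops K "join K" "meet K"
    by (rule lattice_ops_of_lattice) (rule assms)
  interpret L: lattice_ops L "join L" "meet L"
    by (rule lattice_ops_of_lattice) (rule assms)
  define up where "up F = {y \<in> carrier L. \<exists>x\<in>F. f x \<sqsubseteq>\<^bsub>L\<^esub> y}" for F
  define tr where "tr F = {x \<in> carrier K. f x \<in> F}" for F
  have fc: "x \<in> carrier K \<Longrightarrow> f x \<in> carrier L" for x
    using f by auto
  have f_up: "f x \<in> up F" if "F \<in> Filt K" "x \<in> F" for F x
    using that FiltD(1)[OF that(1)] fc L.refl unfolding up_def by blast
  have tr_up: "tr (up F) = F" if F: "F \<in> Filt K" for F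
  proof
    show "F \<subseteq> tr (up F)"
      using F f_up FiltD(1)[OF F] unfolding tr_def by blast
    show "tr (up F) \<subseteq> F"
    proof
      fix x assume "x \<in> tr (up F)"
      then obtain z where "x \<in> carrier K" "z \<in> F" "f z \<sqsubseteq>\<^bsub>L\<^esub> f x"
        unfolding tr_def up_def by blast
      then show "x \<in> F"
        using F FiltD(1)[OF F] FiltD(4)[OF F, of z x] emb[of z x] by blast
    qed
  qed
  have up: "up F \<in> Filt L" if F: "F \<in> Filt K" for F
  proof -
    note FD = FiltD[OF F]
    obtain z where "z \<in> F"
      using FD(2) by blast
    then have z: "f z \<in> up F"
      by (rule f_up[OF F])
    show ?thesis
    proof (rule FiltI)
      show "up F \<subseteq> carrier L"
        by (auto simp: up_def)
      show "f z \<in> up F"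
        by (rule z)
    next
      fix y y' assume y: "y \<in> up F" "y' \<in> up F"
      then obtain x x' where x: "x \<in> F" "x' \<in> F" "f x \<sqsubseteq>\<^bsub>L\<^esub> y" "f x' \<sqsubseteq>\<^bsub>L\<^esub> y'"
        and c: "y \<in> carrier L" "y' \<in> carrier L"
        unfolding up_def by blast
      have xc: "x \<in> carrier K" "x' \<in> carrier K" and xF: "x \<sqinter>\<^bsub>K\<^esub> x' \<in> F"
        using x FD by blast+
      have "f (x \<sqinter>\<^bsub>K\<^esub> x') \<sqsubseteq>\<^bsub>L\<^esub> y \<sqinter>\<^bsub>L\<^esub> y'"
        unfolding meet[OF xc] using x c xc by (intro L.m_mono fc)
      then show "y \<sqinter>\<^bsub>L\<^esub> y' \<in> up F"
        using xF c L.m_closed unfolding up_def by blast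
    next
      fix y y' assume y: "y \<in> up F" "y' \<in> carrier L" "y \<sqsubseteq>\<^bsub>L\<^esub> y'"
      then obtain x where x: "x \<in> F" "f x \<sqsubseteq>\<^bsub>L\<^esub> y" "y \<in> carrier L"
        unfolding up_def by blast
      moreover have "f x \<sqsubseteq>\<^bsub>L\<^esub> y'"
        using x y FD(1) by (intro L.trans[of "f x" y y'] fc) auto
      ultimately show "y' \<in> up F"
        using y(2) unfolding up_def by blast
    qed
  qed
  have "inj_on up (Filt K)"
    using tr_up by (rule inj_on_inverseI)
  then have le: "|Filt K| \<le>o |Filt L|"
    using up by (intro card_of_ordLeqI[of up]) auto
  have tr: "tr F \<in> Filt K" if F: "F \<in> Filt L" for F
  proof (rule FiltI)
    note FD = FiltD[OF F]
    show "tr F \<subseteq> carrier K"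
      by (auto simp: tr_def)
    obtain y where "y \<in> F"
      using FD(2) by blast
    then have "f t \<in> F"
      using FD(1) top fc by (intro FD(4)[of y "f t"]) auto
    then show "t \<in> tr F"
      using top(1) by (simp add: tr_def)
    show "\<And>x y. \<lbrakk>x \<in> tr F; y \<in> tr F\<rbrakk> \<Longrightarrow> x \<sqinter>\<^bsub>K\<^esub> y \<in> tr F"
      unfolding tr_def using FD(3) by (simp add: meet K.m_closed)
    show "\<And>x y. \<lbrakk>x \<in> tr F; y \<in> carrier K; x \<sqsubseteq>\<^bsub>K\<^esub> y\<rbrakk> \<Longrightarrow> y \<in> tr F"
      unfolding tr_def using FD(4) emb fc by blast
  qed
  let ?R = "carrier L - f ` carrier K"
  have "inj_on (\<lambda>F. (tr F, F \<inter> ?R)) (Filt L)"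
  proof (rule inj_onI)
    fix F G assume FG: "F \<in> Filt L" "G \<in> Filt L" and e: "(tr F, F \<inter> ?R) = (tr G, G \<inter> ?R)"
    have "F = f ` tr F \<union> (F \<inter> ?R)" "G = f ` tr G \<union> (G \<inter> ?R)"
      unfolding tr_def using FiltD(1)[OF FG(1)] FiltD(1)[OF FG(2)] by blast+
    then show "F = G"
      using e by simp
  qed
  then have "|Filt L| \<le>o |Filt K \<times> Pow ?R|"
    using tr by (intro card_of_ordLeqI[of "\<lambda>F. (tr F, F \<inter> ?R)"]) auto
  moreover have "|Filt K \<times> Pow ?R| =o |Filt K|"
    using inf fin
    by (intro conjunct1[OF card_of_Times_infinite])
      (auto intro!: ordLess_imp_ordLeq finite_ordLess_infinite2 exI[of _ "{}"])
  ultimately have "|Filt L| \<le>o |Filt K|"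
    by (rule ordLeq_ordIso_trans)
  then show ?thesis
    using le by (simp add: ordIso_iff_ordLeq)
qed

lemma card_Idl_embedding:
  assumes "lattice K" "lattice L"
    and f: "f \<in> carrier K \<rightarrow> carrier L"
    and emb: "\<And>x y. \<lbrakk>x \<in> carrier K; y \<in> carrier K\<rbrakk> \<Longrightarrow> f x \<sqsubseteq>\<^bsub>L\<^esub> f y \<longleftrightarrow> x \<sqsubseteq>\<^bsub>K\<^esub> y"
    and join: "\<And>x y. \<lbrakk>x \<in> carrier K; y \<in> carrier K\<rbrakk> \<Longrightarrow> f (x \<squnion>\<^bsub>K\<^esub> y) = f x \<squnion>\<^bsub>L\<^esub> f y"
    and bot: "b \<in> carrier K" "\<And>y. y \<in> carrier L \<Longrightarrow> f b \<sqsubseteq>\<^bsub>L\<^esub> y"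
    and fin: "finite (carrier L - f ` carrier K)" and inf: "infinite (Idl K)"
  shows "|Idl L| =o |Idl K|"
proof -
  show ?thesis
    unfolding Idl_dual
  proof (rule card_Filt_embedding[where f = f and t = b])
    show "lattice (inv_gorder K)" "lattice (inv_gorder L)"
      by (rule lattice.dual_lattice, fact)+
    show "infinite (Filt (inv_gorder K))"
      using inf unfolding Idl_dual .
    show "f \<in> carrier (inv_gorder K) \<rightarrow> carrier (inv_gorder L)"
      using f by simp
    show "b \<in> carrier (inv_gorder K)" "finite (carrier (inv_gorder L) - f ` carrier (inv_gorder K))"
      using bot(1) fin by simp_all
    show "f x \<sqsubseteq>\<^bsub>inv_gorder L\<^esub> f y \<longleftrightarrow> x \<sqsubseteq>\<^bsub>inv_gorder K\<^esub> y"
      if "x \<in> carrier (inv_gorder K)" "y \<in> carrier (inv_gorder K)" for x y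
      using that by (simp add: emb)
    show "f (x \<sqinter>\<^bsub>inv_gorder K\<^esub> y) = f x \<sqinter>\<^bsub>inv_gorder L\<^esub> f y"
      if "x \<in> carrier (inv_gorder K)" "y \<in> carrier (inv_gorder K)" for x y
      using that by (simp add: join)
    show "y \<sqsubseteq>\<^bsub>inv_gorder L\<^esub> f b" if "y \<in> carrier (inv_gorder L)" for y
      using that by (simp add: bot(2))
  qed
qed

section \<open>Congruences\<close>

lemma ConD:
  assumes "\<theta> \<in> Con L"
  shows "\<theta> \<subseteq> carrier L \<times> carrier L"
    and "\<And>x. x \<in> carrier L \<Longrightarrow> (x, x) \<in> \<theta>"
    and "\<And>x y. (x, y) \<in> \<theta> \<Longrightarrow> (y, x) \<in> \<theta>"
    and "\<And>x y z. \<lbrakk>(x, y) \<in> \<theta>; (y, z) \<in> \<theta>\<rbrakk> \<Longrightarrow> (x, z) \<in> \<theta>"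
  using assms unfolding Con_def equiv_def refl_on_def sym_def trans_def by blast+

context lattice_ops
begin

lemma Con_iff:
  "\<theta> \<in> Con L \<longleftrightarrow> equiv (carrier L) \<theta> \<and>
    (\<forall>x x' y y'. (x, x') \<in> \<theta> \<longrightarrow> (y, y') \<in> \<theta> \<longrightarrow> (j x y, j x' y') \<in> \<theta> \<and> (m x y, m x' y') \<in> \<theta>)"
proof -
  have "x \<squnion> y = j x y \<and> x \<sqinter> y = m x y \<and> x' \<squnion> y' = j x' y' \<and> x' \<sqinter> y' = m x' y'"
    if "equiv (carrier L) \<theta>" "(x, x') \<in> \<theta>" "(y, y') \<in> \<theta>" for x x' y y'
  proof -
    have "{x, x', y, y'} \<subseteq> carrier L"
      using that equiv_type by blast
    then show ?thesis
      by (simp add: join_eq meet_eq)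
  qed
  then show ?thesis
    unfolding Con_def by (auto 0 4)
qed

lemma Con_j: "\<lbrakk>\<theta> \<in> Con L; (x, x') \<in> \<theta>; (y, y') \<in> \<theta>\<rbrakk> \<Longrightarrow> (j x y, j x' y') \<in> \<theta>"
  and Con_m: "\<lbrakk>\<theta> \<in> Con L; (x, x') \<in> \<theta>; (y, y') \<in> \<theta>\<rbrakk> \<Longrightarrow> (m x y, m x' y') \<in> \<theta>"
  unfolding Con_iff by blast+

lemma Id_on_Con: "Id_on (carrier L) \<in> Con L"
  unfolding Con_iff
  by (auto simp: equiv_def refl_on_def sym_def trans_def j_closed m_closed)

lemma full_Con: "carrier L \<times> carrier L \<in> Con L"
  unfolding Con_iff
  by (auto simp: equiv_def refl_on_def sym_def trans_def j_closed m_closed)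

text \<open>From \<open>b\<close> related to \<open>t\<close>, meeting with \<open>x\<close> relates \<open>b\<close> to every \<open>x\<close>.\<close>

lemma Con_eq_full:
  assumes \<theta>: "\<theta> \<in> Con L" "(b, t) \<in> \<theta>"
    and b: "\<And>x. x \<in> carrier L \<Longrightarrow> b \<sqsubseteq> x" and t: "\<And>x. x \<in> carrier L \<Longrightarrow> x \<sqsubseteq> t"
  shows "\<theta> = carrier L \<times> carrier L"
proof -
  note C = ConD[OF \<theta>(1)]
  have bt: "b \<in> carrier L" "t \<in> carrier L"
    using C(1) \<theta>(2) by auto
  have bx: "(b, x) \<in> \<theta>" if "x \<in> carrier L" for x
  proof -
    have "m b x = b"
      using le_iff_m[of b x] bt that b by blast
    moreover have "m t x = x"
      using bt that t by (intro antisym m_right m_greatest m_closed refl)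
    ultimately show ?thesis
      using Con_m[OF \<theta> C(2)[OF that]] by simp
  qed
  have "(x, y) \<in> \<theta>" if "x \<in> carrier L" "y \<in> carrier L" for x y
    using C(4)[OF C(3)[OF bx] bx] that by blast
  then show ?thesis
    using C(1) by auto
qed

end

definition complementary :: "('a, 'm) gorder_scheme \<Rightarrow> 'a \<Rightarrow> 'a \<Rightarrow> bool" where
  "complementary L x y \<longleftrightarrow> x \<in> carrier L \<and> y \<in> carrier L \<and> x \<sqinter>\<^bsub>L\<^esub> y = \<bottom>\<^bsub>L\<^esub> \<and> x \<squnion>\<^bsub>L\<^esub> y = \<top>\<^bsub>L\<^esub>"

text \<open>Unless the lattice is trivial, three pairwise complementary elements and the bounds of the
  lattice form a copy of the five-element modular lattice \<open>M\<^sub>3\<close>.  It is simple, so a congruence that moves one of the three to a bound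
  identifies the two bounds.\<close>

lemma M3_collapse:
  assumes L: "bounded_lattice L" and \<theta>: "\<theta> \<in> Con L"
    and complementary: "complementary L u v" "complementary L u w" "complementary L v w"
    and u: "(u, \<bottom>\<^bsub>L\<^esub>) \<in> \<theta> \<or> (u, \<top>\<^bsub>L\<^esub>) \<in> \<theta>"
  shows "\<theta> = carrier L \<times> carrier L"
proof -
  interpret bounded_lattice L by (rule L)
  interpret ops: lattice_ops L "join L" "meet L"
    by (rule lattice_ops_of_lattice) (rule lattice_axioms)
  note C = ConD[OF \<theta>]
  have simps: "x \<sqinter>\<^bsub>L\<^esub> \<bottom>\<^bsub>L\<^esub> = \<bottom>\<^bsub>L\<^esub>" "\<bottom>\<^bsub>L\<^esub> \<sqinter>\<^bsub>L\<^esub> x = \<bottom>\<^bsub>L\<^esub>" "x \<sqinter>\<^bsub>L\<^esub> \<top>\<^bsub>L\<^esub> = x" "\<top>\<^bsub>L\<^esub> \<sqinter>\<^bsub>L\<^esub> x = x"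
      "\<bottom>\<^bsub>L\<^esub> \<squnion>\<^bsub>L\<^esub> x = x"
    if "x \<in> carrier L" for x
    using that bottom_meet[of x] bottom_join[of x] top_meet[of x]
    by (auto simp: eq_is_equal meet_comm[of L x])
  have collapse: "\<theta> = carrier L \<times> carrier L"
    if "complementary L u v" "complementary L u w" "complementary L v w" "(u, \<bottom>\<^bsub>L\<^esub>) \<in> \<theta>" for u v w
  proof -
    have c: "u \<in> carrier L" "v \<in> carrier L" "w \<in> carrier L"
      using that by (auto simp: complementary_def)
    have "(\<top>\<^bsub>L\<^esub>, v) \<in> \<theta>"
      using ops.Con_j[OF \<theta> that(4) C(2)[OF c(2)]] that(1) c by (simp add: complementary_def simps)
    then have "(w, \<bottom>\<^bsub>L\<^esub>) \<in> \<theta>"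
      using ops.Con_m[OF \<theta> _ C(2)[OF c(3)], of "\<top>\<^bsub>L\<^esub>" v] that(3) c
      by (simp add: complementary_def simps)
    moreover have "(\<top>\<^bsub>L\<^esub>, w) \<in> \<theta>"
      using ops.Con_j[OF \<theta> that(4) C(2)[OF c(3)]] that(2) c by (simp add: complementary_def simps)
    ultimately have "(\<bottom>\<^bsub>L\<^esub>, \<top>\<^bsub>L\<^esub>) \<in> \<theta>"
      using C(3,4) by blast
    then show ?thesis
      by (rule ops.Con_eq_full[OF \<theta>]) auto
  qed
  show ?thesis
    using u
  proof
    assume "(u, \<top>\<^bsub>L\<^esub>) \<in> \<theta>"
    moreover have c: "v \<in> carrier L"
      using complementary by (auto simp: complementary_def)
    ultimately have "(\<bottom>\<^bsub>L\<^esub>, v) \<in> \<theta>"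
      using ops.Con_m[OF \<theta> _ C(2)[OF c], of u "\<top>\<^bsub>L\<^esub>"] complementary(1) c
      by (simp add: complementary_def simps)
    then have "(v, \<bottom>\<^bsub>L\<^esub>) \<in> \<theta>"
      by (rule C(3))
    moreover have "complementary L v u"
      using complementary(1) by (simp add: complementary_def join_comm[of L v] meet_comm[of L v])
    ultimately show ?thesis
      using collapse complementary by blast
  qed (use collapse complementary in blast)
qed

section \<open>The horizontal sum with the four-element Boolean lattice\<close>

lemma L22_ops: "lattice_ops L22
    (\<lambda>x y. (fst x \<or> fst y, snd x \<or> snd y))
    (\<lambda>x y. (fst x \<and> fst y, snd x \<and> snd y))"
  by unfold_locales (auto simp: L22_def)

lemma L22_bounds: "\<bottom>\<^bsub>L22\<^esub> = (False, False)" "\<top>\<^bsub>L22\<^esub> = (True, True)"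
  by (rule lattice_ops.bottom_eq[OF L22_ops] lattice_ops.top_eq[OF L22_ops]; simp add: L22_def)+

lemma L22_carrier: "carrier L22 = UNIV"
  and L22_le: "x \<sqsubseteq>\<^bsub>L22\<^esub> y \<longleftrightarrow> fst x \<le> fst y \<and> snd x \<le> snd y"
  by (simp_all add: L22_def)

locale hsum_L22 = bounded_lattice S for S :: "('a, 'm) gorder_scheme" +
  assumes bottom_neq_top: "\<bottom>\<^bsub>S\<^esub> \<noteq> \<top>\<^bsub>S\<^esub>"
begin

abbreviation "H \<equiv> S \<boxplus> L22"

abbreviation is_atom :: "bool \<times> bool \<Rightarrow> bool" where
  "is_atom c \<equiv> fst c \<noteq> snd c"

lemma carrier_H: "carrier H = Inl ` carrier S \<union> Inr ` {c. is_atom c}"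
  by (auto simp: hsum_def hsum_in2_def L22_bounds L22_carrier L22_le image_iff split: if_splits)

lemma Inl_carrier [simp]: "Inl x \<in> carrier H \<longleftrightarrow> x \<in> carrier S"
  and Inr_carrier [simp]: "Inr c \<in> carrier H \<longleftrightarrow> is_atom c"
  by (auto simp: carrier_H)

lemma eq_H: "eq H = (=)"
  by (simp add: hsum_def)

lemma ex_bool_pair:
  "(\<exists>c :: bool \<times> bool. Q c) \<longleftrightarrow>
    Q (False, False) \<or> Q (False, True) \<or> Q (True, False) \<or> Q (True, True)"
  by (simp add: split_paired_Ex ex_bool_eq) blast

lemma le_H [simp]:
  "Inl x \<sqsubseteq>\<^bsub>H\<^esub> Inl y \<longleftrightarrow> x \<in> carrier S \<and> y \<in> carrier S \<and> x \<sqsubseteq>\<^bsub>S\<^esub> y"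
  "Inl x \<sqsubseteq>\<^bsub>H\<^esub> Inr c \<longleftrightarrow> x = \<bottom>\<^bsub>S\<^esub> \<and> is_atom c"
  "Inr c \<sqsubseteq>\<^bsub>H\<^esub> Inl x \<longleftrightarrow> x = \<top>\<^bsub>S\<^esub> \<and> is_atom c"
  "Inr c \<sqsubseteq>\<^bsub>H\<^esub> Inr d \<longleftrightarrow> c = d \<and> is_atom c"
  by (cases c; cases d; simp add: hsum_def hsum_in2_def L22_bounds L22_carrier L22_le ex_bool_pair;
      use bottom_neq_top in auto)+

definition hjoin :: "'a + bool \<times> bool \<Rightarrow> 'a + bool \<times> bool \<Rightarrow> 'a + bool \<times> bool" where
  "hjoin u v = (case u of
      Inl x \<Rightarrow> (case v of Inl y \<Rightarrow> Inl (x \<squnion>\<^bsub>S\<^esub> y) | Inr d \<Rightarrow> if x = \<bottom>\<^bsub>S\<^esub> then Inr d else Inl \<top>\<^bsub>S\<^esub>)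
    | Inr c \<Rightarrow> (case v of Inl y \<Rightarrow> if y = \<bottom>\<^bsub>S\<^esub> then Inr c else Inl \<top>\<^bsub>S\<^esub>
                        | Inr d \<Rightarrow> if c = d then Inr c else Inl \<top>\<^bsub>S\<^esub>))"

definition hmeet :: "'a + bool \<times> bool \<Rightarrow> 'a + bool \<times> bool \<Rightarrow> 'a + bool \<times> bool" where
  "hmeet u v = (case u of
      Inl x \<Rightarrow> (case v of Inl y \<Rightarrow> Inl (x \<sqinter>\<^bsub>S\<^esub> y) | Inr d \<Rightarrow> if x = \<top>\<^bsub>S\<^esub> then Inr d else Inl \<bottom>\<^bsub>S\<^esub>)
    | Inr c \<Rightarrow> (case v of Inl y \<Rightarrow> if y = \<top>\<^bsub>S\<^esub> then Inr c else Inl \<bottom>\<^bsub>S\<^esub>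
                        | Inr d \<Rightarrow> if c = d then Inr c else Inl \<bottom>\<^bsub>S\<^esub>))"

sublocale H: lattice_ops H hjoin hmeet
proof -
  interpret S: lattice_ops S "join S" "meet S"
    by (rule lattice_ops_of_lattice) (rule lattice_axioms)
  have bt: "x \<sqsubseteq>\<^bsub>S\<^esub> \<bottom>\<^bsub>S\<^esub> \<longleftrightarrow> x = \<bottom>\<^bsub>S\<^esub>" "\<top>\<^bsub>S\<^esub> \<sqsubseteq>\<^bsub>S\<^esub> x \<longleftrightarrow> x = \<top>\<^bsub>S\<^esub>" if "x \<in> carrier S" for x
    using that S.antisym by blast+
  note simps = hjoin_def hmeet_def carrier_H eq_H bottom_neq_top bottom_neq_top[symmetric] bt
    S.refl S.j_closed S.m_closed S.j_left S.j_right S.m_left S.m_right S.j_least S.m_greatest S.idem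
  show "lattice_ops H hjoin hmeet"
  proof (unfold_locales, goal_cases)
    case (3 x y) then show ?case by (auto simp: simps intro: S.antisym)
  next
    case (4 x y z) then show ?case by (auto simp: simps intro: S.trans)
  qed (auto simp: simps split: if_splits)
qed

lemma H_bounded: "bounded_lattice H" and H_bottom: "\<bottom>\<^bsub>H\<^esub> = Inl \<bottom>\<^bsub>S\<^esub>" and H_top: "\<top>\<^bsub>H\<^esub> = Inl \<top>\<^bsub>S\<^esub>"
  by (rule H.bounded_latticeI[of "Inl \<bottom>\<^bsub>S\<^esub>" "Inl \<top>\<^bsub>S\<^esub>"] H.bottom_eq H.top_eq; auto simp: carrier_H)+

lemma H_compl:
  assumes "x \<in> carrier S" "x \<noteq> \<bottom>\<^bsub>S\<^esub>" "x \<noteq> \<top>\<^bsub>S\<^esub>" "is_atom c" "is_atom d" "c \<noteq> d"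
  shows "complementary H (Inl x) (Inr c)" "complementary H (Inr c) (Inl x)"
    "complementary H (Inr c) (Inr d)"
  using assms by (auto simp: complementary_def H.join_eq H.meet_eq H_bottom H_top hjoin_def hmeet_def)

lemma restrict_Con:
  assumes "\<theta> \<in> Con H"
  shows "{(x, y). (Inl x, Inl y) \<in> \<theta>} \<in> Con S"
proof -
  interpret S: lattice_ops S "join S" "meet S"
    by (rule lattice_ops_of_lattice) (rule lattice_axioms)
  note C = ConD[OF assms]
  have "(Inl (x \<squnion>\<^bsub>S\<^esub> y), Inl (x' \<squnion>\<^bsub>S\<^esub> y')) \<in> \<theta> \<and> (Inl (x \<sqinter>\<^bsub>S\<^esub> y), Inl (x' \<sqinter>\<^bsub>S\<^esub> y')) \<in> \<theta>"
    if "(Inl x, Inl x') \<in> \<theta>" "(Inl y, Inl y') \<in> \<theta>" for x x' y y'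
    using H.Con_j[OF assms that] H.Con_m[OF assms that] by (simp add: hjoin_def hmeet_def)
  moreover have "equiv (carrier S) {(x, y). (Inl x, Inl y) \<in> \<theta>}"
  proof (rule equivI)
    show "{(x, y). (Inl x, Inl y) \<in> \<theta>} \<subseteq> carrier S \<times> carrier S"
      using C(1) by auto
    show "refl_on (carrier S) {(x, y). (Inl x, Inl y) \<in> \<theta>}"
      using C(2) by (simp add: refl_on_def)
    show "sym {(x, y). (Inl x, Inl y) \<in> \<theta>}"
      using C(3) by (simp add: sym_def)
    show "trans {(x, y). (Inl x, Inl y) \<in> \<theta>}"
      using C(4) unfolding trans_def by blast
  qed
  ultimately show ?thesis
    unfolding S.Con_iff by blast
qed

text \<open>Any element other than the bounds forms, together with two others, a triple of pairwise
  complementary elements; hence a proper congruence has singleton classes at the bounds, and its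
  restriction to the first summand lies in \<^term>\<open>Con01 S\<close>.  An atom of the second summand cannot
  be related to another element except possibly the top, because meeting with the atom would relate
  it to the bottom; and the class of the top is a singleton.\<close>

lemma simple_H:
  assumes Con01: "Con01 S = {Id_on (carrier S)}"
    and s: "s \<in> carrier S" "s \<noteq> \<bottom>\<^bsub>S\<^esub>" "s \<noteq> \<top>\<^bsub>S\<^esub>"
  shows "simple_lattice H"
proof -
  have "\<theta> = Id_on (carrier H)" if \<theta>: "\<theta> \<in> Con H" "\<theta> \<noteq> carrier H \<times> carrier H" for \<theta>
  proof -
    note C = ConD[OF \<theta>(1)]
    have triple: "\<exists>v w. complementary H u v \<and> complementary H u w \<and> complementary H v w"
      if u: "u \<in> carrier H" "u \<noteq> \<bottom>\<^bsub>H\<^esub>" "u \<noteq> \<top>\<^bsub>H\<^esub>" for u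
    proof (cases u)
      case (Inl x)
      then have "complementary H u (Inr (True, False))" "complementary H u (Inr (False, True))"
        "complementary H (Inr (True, False)) (Inr (False, True))"
        using u H_compl[of x "(True, False)" "(False, True)"]
          H_compl[of x "(False, True)" "(True, False)"]
        by (auto simp: H_bottom H_top)
      then show ?thesis
        by blast
    next
      case (Inr c)
      then have c: "is_atom c" "is_atom (prod.swap c)" "c \<noteq> prod.swap c"
        using u by (auto simp: prod_eq_iff)
      then show ?thesis
        using H_compl[OF s c] H_compl[OF s c(2,1) c(3)[symmetric]] Inr by blast
    qed
    have isolated: "u = \<bottom>\<^bsub>H\<^esub>" if "(u, \<bottom>\<^bsub>H\<^esub>) \<in> \<theta>" for u
    proof (rule ccontr)
      assume "u \<noteq> \<bottom>\<^bsub>H\<^esub>"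
      have "u \<noteq> \<top>\<^bsub>H\<^esub>"
      proof
        assume "u = \<top>\<^bsub>H\<^esub>"
        then have "(Inl \<bottom>\<^bsub>S\<^esub>, Inl \<top>\<^bsub>S\<^esub>) \<in> \<theta>"
          using that C(3) by (simp add: H_bottom H_top)
        then have "\<theta> = carrier H \<times> carrier H"
          by (rule H.Con_eq_full[OF \<theta>(1)]) (auto simp: carrier_H)
        with \<theta>(2) show False ..
      qed
      moreover have "u \<in> carrier H"
        using that C(1) by auto
      ultimately show False
        using triple[of u] M3_collapse[OF H_bounded \<theta>(1)] that \<theta>(2) \<open>u \<noteq> \<bottom>\<^bsub>H\<^esub>\<close> by blast
    qed
    have isolated': "u = \<top>\<^bsub>H\<^esub>" if "(u, \<top>\<^bsub>H\<^esub>) \<in> \<theta>" for u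
    proof (rule ccontr)
      assume "u \<noteq> \<top>\<^bsub>H\<^esub>"
      moreover have "u \<noteq> \<bottom>\<^bsub>H\<^esub>"
        using that C(3) isolated[of "\<top>\<^bsub>H\<^esub>"] \<open>u \<noteq> \<top>\<^bsub>H\<^esub>\<close> by auto
      moreover have "u \<in> carrier H"
        using that C(1) by auto
      ultimately show False
        using triple[of u] M3_collapse[OF H_bounded \<theta>(1)] that \<theta>(2) by blast
    qed
    have "{(x, y). (Inl x, Inl y) \<in> \<theta>} \<in> Con01 S"
      using restrict_Con[OF \<theta>(1)] isolated isolated' C(2,3)
      unfolding Con01_def H_bottom H_top by fastforce
    then have Inl: "x = y" if "(Inl x, Inl y) \<in> \<theta>" for x y
      using that Con01 by (auto simp: set_eq_iff)
    have Inr: "u = Inr c" if "(Inr c, u) \<in> \<theta>" for c u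
    proof (rule ccontr)
      assume "u \<noteq> Inr c"
      have c: "Inr c \<in> carrier H"
        using that C(1) by auto
      have "u \<noteq> \<top>\<^bsub>H\<^esub>"
        using that isolated'[of "Inr c"] by (auto simp: H_top)
      then have "hmeet (Inr c) u = \<bottom>\<^bsub>H\<^esub>"
        using \<open>u \<noteq> Inr c\<close> by (auto simp: hmeet_def H_bottom H_top split: sum.split)
      moreover have "hmeet (Inr c) (Inr c) = Inr c"
        by (simp add: hmeet_def)
      ultimately have "(Inr c, \<bottom>\<^bsub>H\<^esub>) \<in> \<theta>"
        using H.Con_m[OF \<theta>(1) C(2)[OF c] that] by simp
      then show False
        using isolated[of "Inr c"] by (simp add: H_bottom)
    qed
    have "u = v" if "(u, v) \<in> \<theta>" for u v
      using that C(3)[OF that] Inl Inr by (cases u; cases v) metis+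
    then show ?thesis
      using C(1,2) by auto
  qed
  then have "Con H = {Id_on (carrier H), carrier H \<times> carrier H}"
    using H.Id_on_Con H.full_Con by blast
  moreover have "Id_on (carrier H) \<noteq> carrier H \<times> carrier H"
  proof -
    have "(Inl \<bottom>\<^bsub>S\<^esub>, Inl \<top>\<^bsub>S\<^esub>) \<in> carrier H \<times> carrier H - Id_on (carrier H)"
      using bottom_neq_top by auto
    then show ?thesis
      by blast
  qed
  ultimately show ?thesis
    using H.lattice by (simp add: simple_lattice_def)
qed

lemma finite_new_elements: "finite (carrier H - Inl ` carrier S)"
  by (rule finite_subset[of _ "range Inr"]) (auto simp: carrier_H)

lemma card_Filt_H:
  assumes "infinite (Filt S)"
  shows "|Filt H| =o |Filt S|"
  using assms lattice_axioms H.lattice finite_new_elements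
  by (intro card_Filt_embedding[where f = Inl and t = "\<top>\<^bsub>S\<^esub>"])
    (auto simp: H.meet_eq hmeet_def carrier_H)

lemma card_Idl_H:
  assumes "infinite (Idl S)"
  shows "|Idl H| =o |Idl S|"
  using assms lattice_axioms H.lattice finite_new_elements
  by (intro card_Idl_embedding[where f = Inl and b = "\<bottom>\<^bsub>S\<^esub>"])
    (auto simp: H.join_eq hjoin_def carrier_H)

end

section \<open>Products with a new top\<close>

lemma prod_lattice_ops:
  assumes "\<And>i. i \<in> M \<Longrightarrow> lattice (A i)"
  shows "lattice_ops (prod_lattice M A)
    (\<lambda>x y. \<lambda>i\<in>M. x i \<squnion>\<^bsub>A i\<^esub> y i) (\<lambda>x y. \<lambda>i\<in>M. x i \<sqinter>\<^bsub>A i\<^esub> y i)"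
proof -
  note ops = lattice_ops_of_lattice[OF assms]
  have c: "x i \<in> carrier (A i)" if "x \<in> (\<Pi>\<^sub>E i\<in>M. carrier (A i))" "i \<in> M" for x i
    using that by (rule PiE_mem)
  show ?thesis
  proof (unfold_locales, goal_cases)
    case (3 x y)
    then show ?case
      using lattice_ops.antisym[OF ops] c
      by (intro PiE_ext[of x M _ y]) (auto simp: prod_lattice_def)
  next
    case (4 x y z)
    then show ?case
      using lattice_ops.trans[OF ops _ _ c c c, of _ x y z] by (simp add: prod_lattice_def)
  qed (simp_all add: prod_lattice_def c lattice_ops.refl[OF ops]
      lattice_ops.j_closed[OF ops] lattice_ops.m_closed[OF ops] lattice_ops.j_left[OF ops]
      lattice_ops.j_right[OF ops] lattice_ops.m_left[OF ops] lattice_ops.m_right[OF ops]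
      lattice_ops.j_least[OF ops] lattice_ops.m_greatest[OF ops])
qed

definition top_join :: "('a \<Rightarrow> 'a \<Rightarrow> 'a) \<Rightarrow> 'a option \<Rightarrow> 'a option \<Rightarrow> 'a option" where
  "top_join j x y = (case x of None \<Rightarrow> None | Some a \<Rightarrow> map_option (j a) y)"

definition top_meet :: "('a \<Rightarrow> 'a \<Rightarrow> 'a) \<Rightarrow> 'a option \<Rightarrow> 'a option \<Rightarrow> 'a option" where
  "top_meet m x y = (case x of None \<Rightarrow> y | Some a \<Rightarrow> (case y of None \<Rightarrow> x | Some b \<Rightarrow> Some (m a b)))"

lemma add_top_ops:
  assumes "lattice_ops L j m"
  shows "lattice_ops (add_top L) (top_join j) (top_meet m)"
proof -
  interpret lattice_ops L j m by (rule assms)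
  show ?thesis
  proof (unfold_locales, goal_cases)
    case (3 x y)
    then show ?case by (auto simp: add_top_def intro: antisym)
  next
    case (4 x y z)
    then show ?case by (auto simp: add_top_def intro: trans)
  qed (auto simp: add_top_def top_join_def top_meet_def refl j_closed m_closed j_left j_right
      m_left m_right j_least m_greatest)
qed

text \<open>A minimal member is least, since its meet with any other member is again a member.\<close>

lemma dcc_least:
  assumes L: "lattice L" "dcc L" and X: "X \<subseteq> carrier L" "X \<noteq> {}"
    and meet: "\<And>x y. \<lbrakk>x \<in> X; y \<in> X\<rbrakk> \<Longrightarrow> x \<sqinter>\<^bsub>L\<^esub> y \<in> X"
  shows "\<exists>x\<in>X. \<forall>y\<in>X. x \<sqsubseteq>\<^bsub>L\<^esub> y"
proof -
  interpret lattice_ops L "join L" "meet L"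
    by (rule lattice_ops_of_lattice) (rule L)
  have "\<exists>x\<in>X. \<forall>y\<in>X. \<not> y \<sqsubset>\<^bsub>L\<^esub> x"
  proof (rule ccontr)
    assume "\<not> ?thesis"
    then have "\<exists>f. \<forall>n. f n \<in> X \<and> f (Suc n) \<sqsubset>\<^bsub>L\<^esub> f n"
      using X(2) by (intro dependent_nat_choice) auto
    then show False
      using L(2) X(1) unfolding dcc_def by blast
  qed
  then obtain x where x: "x \<in> X" "\<And>y. y \<in> X \<Longrightarrow> \<not> y \<sqsubset>\<^bsub>L\<^esub> x"
    by blast
  have "x \<sqsubseteq>\<^bsub>L\<^esub> y" if y: "y \<in> X" for y
  proof -
    have c: "x \<in> carrier L" "y \<in> carrier L"
      using x(1) y X(1) by auto
    have "\<not> x \<sqinter>\<^bsub>L\<^esub> y \<sqsubset>\<^bsub>L\<^esub> x"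
      using x meet y by blast
    then have "x \<sqinter>\<^bsub>L\<^esub> y = x"
      using c m_left by (simp add: lless_def eq)
    then show ?thesis
      using c le_iff_m by blast
  qed
  with x(1) show ?thesis
    by blast
qed

section \<open>Finitely supported families with a new top\<close>

locale lattice_family =
  fixes M :: "'i set" and A :: "'i \<Rightarrow> 'a gorder"
  assumes lattice_A: "i \<in> M \<Longrightarrow> lattice (A i)"
    and dcc_A: "i \<in> M \<Longrightarrow> dcc (A i)"
    and nonempty_A: "i \<in> M \<Longrightarrow> carrier (A i) \<noteq> {}"
begin

lemmas ops_A = lattice_ops_of_lattice[OF lattice_A]

lemma bottom_A: "i \<in> M \<Longrightarrow> \<bottom>\<^bsub>A i\<^esub> \<in> carrier (A i)"
  and bottom_A_le: "\<lbrakk>i \<in> M; x \<in> carrier (A i)\<rbrakk> \<Longrightarrow> \<bottom>\<^bsub>A i\<^esub> \<sqsubseteq>\<^bsub>A i\<^esub> x"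
proof -
  have *: "\<bottom>\<^bsub>A i\<^esub> \<in> carrier (A i) \<and> (\<forall>x\<in>carrier (A i). \<bottom>\<^bsub>A i\<^esub> \<sqsubseteq>\<^bsub>A i\<^esub> x)" if i: "i \<in> M" for i
  proof -
    interpret lattice_ops "A i" "join (A i)" "meet (A i)"
      by (rule ops_A) (rule i)
    obtain b where b: "b \<in> carrier (A i)" "\<forall>x\<in>carrier (A i). b \<sqsubseteq>\<^bsub>A i\<^esub> x"
      using dcc_least[OF lattice_A[OF i] dcc_A[OF i] order_refl nonempty_A[OF i]] m_closed by blast
    then have "\<bottom>\<^bsub>A i\<^esub> = b"
      by (intro bottom_eq) auto
    with b show ?thesis
      by simp
  qed
  show "i \<in> M \<Longrightarrow> \<bottom>\<^bsub>A i\<^esub> \<in> carrier (A i)" "\<lbrakk>i \<in> M; x \<in> carrier (A i)\<rbrakk> \<Longrightarrow> \<bottom>\<^bsub>A i\<^esub> \<sqsubseteq>\<^bsub>A i\<^esub> x"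
    using * by auto
qed

lemma le_bottom_A: "\<lbrakk>i \<in> M; x \<in> carrier (A i); x \<sqsubseteq>\<^bsub>A i\<^esub> \<bottom>\<^bsub>A i\<^esub>\<rbrakk> \<Longrightarrow> x = \<bottom>\<^bsub>A i\<^esub>"
  by (blast intro: lattice_ops.antisym[OF ops_A] bottom_A bottom_A_le)

lemma bottom_A_simps:
  assumes "i \<in> M" "x \<in> carrier (A i)"
  shows "x \<squnion>\<^bsub>A i\<^esub> \<bottom>\<^bsub>A i\<^esub> = x" "\<bottom>\<^bsub>A i\<^esub> \<squnion>\<^bsub>A i\<^esub> x = x"
    "x \<sqinter>\<^bsub>A i\<^esub> \<bottom>\<^bsub>A i\<^esub> = \<bottom>\<^bsub>A i\<^esub>" "\<bottom>\<^bsub>A i\<^esub> \<sqinter>\<^bsub>A i\<^esub> x = \<bottom>\<^bsub>A i\<^esub>"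
proof -
  interpret lattice_ops "A i" "join (A i)" "meet (A i)"
    by (rule ops_A) (rule assms)
  show "\<bottom>\<^bsub>A i\<^esub> \<squnion>\<^bsub>A i\<^esub> x = x" "\<bottom>\<^bsub>A i\<^esub> \<sqinter>\<^bsub>A i\<^esub> x = \<bottom>\<^bsub>A i\<^esub>"
    using le_iff_j le_iff_m bottom_A bottom_A_le assms by blast+
  then show "x \<squnion>\<^bsub>A i\<^esub> \<bottom>\<^bsub>A i\<^esub> = x" "x \<sqinter>\<^bsub>A i\<^esub> \<bottom>\<^bsub>A i\<^esub> = \<bottom>\<^bsub>A i\<^esub>"
    by (simp_all add: join_comm[of "A i" x] meet_comm[of "A i" x])
qed

abbreviation "P \<equiv> prod_lattice M A"
abbreviation "Q \<equiv> add_top P"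

definition pjoin where "pjoin x y = (\<lambda>i\<in>M. x i \<squnion>\<^bsub>A i\<^esub> y i)"
definition pmeet where "pmeet x y = (\<lambda>i\<in>M. x i \<sqinter>\<^bsub>A i\<^esub> y i)"

definition supp :: "('i \<Rightarrow> 'a) \<Rightarrow> 'i set" where
  "supp x = {i \<in> M. x i \<noteq> \<bottom>\<^bsub>A i\<^esub>}"

definition finsupp :: "('i \<Rightarrow> 'a) set" where
  "finsupp = {x \<in> carrier P. finite (supp x)}"

definition S :: "('i \<Rightarrow> 'a) option gorder" where
  "S = Q\<lparr>carrier := insert None (Some ` finsupp)\<rparr>"

definition zero :: "'i \<Rightarrow> 'a" where
  "zero = (\<lambda>i\<in>M. \<bottom>\<^bsub>A i\<^esub>)"

definition single :: "'i \<Rightarrow> 'a \<Rightarrow> 'i \<Rightarrow> 'a" where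
  "single i a = (\<lambda>k\<in>M. if k = i then a else \<bottom>\<^bsub>A k\<^esub>)"

sublocale P: lattice_ops P pjoin pmeet
  using prod_lattice_ops[OF lattice_A] unfolding pjoin_def[abs_def] pmeet_def[abs_def] .

sublocale Q: lattice_ops Q "top_join pjoin" "top_meet pmeet"
  by (rule add_top_ops) (rule P.lattice_ops_axioms)

lemma carrier_P: "x \<in> carrier P \<longleftrightarrow> (\<forall>i\<in>M. x i \<in> carrier (A i)) \<and> x \<in> extensional M"
  by (auto simp: prod_lattice_def PiE_iff)

lemma le_P: "x \<sqsubseteq>\<^bsub>P\<^esub> y \<longleftrightarrow> (\<forall>i\<in>M. x i \<sqsubseteq>\<^bsub>A i\<^esub> y i)"
  by (simp add: prod_lattice_def)

lemma finsupp_mem: "\<lbrakk>x \<in> finsupp; i \<in> M\<rbrakk> \<Longrightarrow> x i \<in> carrier (A i)"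
  by (simp add: finsupp_def carrier_P)

lemma finsupp_ext: "\<lbrakk>x \<in> finsupp; y \<in> finsupp; \<And>i. i \<in> M \<Longrightarrow> x i = y i\<rbrakk> \<Longrightarrow> x = y"
  by (auto simp: finsupp_def carrier_P intro: extensionalityI)

lemma finsupp_outside: "\<lbrakk>i \<in> M; i \<notin> supp x\<rbrakk> \<Longrightarrow> x i = \<bottom>\<^bsub>A i\<^esub>"
  by (simp add: supp_def)

lemma zero_finsupp: "zero \<in> finsupp"
  by (auto simp: finsupp_def carrier_P supp_def zero_def bottom_A)

lemma supp_zero: "supp zero = {}"
  by (auto simp: supp_def zero_def)

lemma supp_single: "supp (single i a) \<subseteq> {i}"
  by (auto simp: supp_def single_def split: if_splits)

lemma single_finsupp: "\<lbrakk>i \<in> M; a \<in> carrier (A i)\<rbrakk> \<Longrightarrow> single i a \<in> finsupp"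
  using finite_subset[OF supp_single]
  by (auto simp: finsupp_def carrier_P single_def bottom_A)

lemma supp_pjoin: "\<lbrakk>x \<in> finsupp; y \<in> finsupp\<rbrakk> \<Longrightarrow> supp (pjoin x y) \<subseteq> supp x \<union> supp y"
  and supp_pmeet: "\<lbrakk>x \<in> finsupp; y \<in> finsupp\<rbrakk> \<Longrightarrow> supp (pmeet x y) \<subseteq> supp x \<union> supp y"
  by (auto simp: supp_def pjoin_def pmeet_def bottom_A_simps bottom_A)

lemma supp_mono: "\<lbrakk>x \<in> finsupp; x \<sqsubseteq>\<^bsub>P\<^esub> y\<rbrakk> \<Longrightarrow> supp x \<subseteq> supp y"
  using le_bottom_A finsupp_mem by (auto simp: supp_def le_P)

lemma pjoin_finsupp: "\<lbrakk>x \<in> finsupp; y \<in> finsupp\<rbrakk> \<Longrightarrow> pjoin x y \<in> finsupp"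
  using finite_subset[OF supp_pjoin] by (simp add: finsupp_def P.j_closed)

lemma pmeet_finsupp: "\<lbrakk>x \<in> finsupp; y \<in> finsupp\<rbrakk> \<Longrightarrow> pmeet x y \<in> finsupp"
  using finite_subset[OF supp_pmeet] by (simp add: finsupp_def P.m_closed)

lemma carrier_Q: "carrier Q = insert None (Some ` carrier P)"
  by (simp add: add_top_def)

lemma carrier_S: "carrier S = insert None (Some ` finsupp)"
  by (simp add: S_def)

lemma S_closed:
  assumes "x \<in> carrier S" "y \<in> carrier S"
  shows "top_join pjoin x y \<in> carrier S" "top_meet pmeet x y \<in> carrier S"
  using assms by (auto simp: carrier_S top_join_def top_meet_def pjoin_finsupp pmeet_finsupp)

lemma S_subset: "carrier S \<subseteq> carrier Q"
  by (auto simp: carrier_Q carrier_S finsupp_def)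

sublocale S: lattice_ops S "top_join pjoin" "top_meet pmeet"
  unfolding S_def
  by (rule Q.sublattice) (use S_subset S_closed in \<open>auto simp: carrier_S\<close>)

lemma le_S [simp]: "x \<sqsubseteq>\<^bsub>S\<^esub> None" "\<not> None \<sqsubseteq>\<^bsub>S\<^esub> Some a" "Some a \<sqsubseteq>\<^bsub>S\<^esub> Some b \<longleftrightarrow> a \<sqsubseteq>\<^bsub>P\<^esub> b"
  by (simp_all add: S_def add_top_def)

lemma le_Q [simp]: "x \<sqsubseteq>\<^bsub>Q\<^esub> None" "Some a \<sqsubseteq>\<^bsub>Q\<^esub> Some b \<longleftrightarrow> a \<sqsubseteq>\<^bsub>P\<^esub> b"
  by (simp_all add: add_top_def)

lemma join_S: "\<lbrakk>x \<in> finsupp; y \<in> finsupp\<rbrakk> \<Longrightarrow> Some x \<squnion>\<^bsub>S\<^esub> Some y = Some (pjoin x y)"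
  and meet_S: "\<lbrakk>x \<in> finsupp; y \<in> finsupp\<rbrakk> \<Longrightarrow> Some x \<sqinter>\<^bsub>S\<^esub> Some y = Some (pmeet x y)"
  by (simp_all add: S.join_eq S.meet_eq carrier_S top_join_def top_meet_def)

lemma zero_le: "x \<in> carrier P \<Longrightarrow> zero \<sqsubseteq>\<^bsub>P\<^esub> x"
  by (simp add: le_P zero_def bottom_A_le carrier_P)

lemma zero_le_Q: "x \<in> carrier Q \<Longrightarrow> Some zero \<sqsubseteq>\<^bsub>Q\<^esub> x"
  by (auto simp: carrier_Q zero_le)

lemma zero_le_S: "x \<in> carrier S \<Longrightarrow> Some zero \<sqsubseteq>\<^bsub>S\<^esub> x"
  by (auto simp: carrier_S zero_le finsupp_def)

lemma bounds_Q: "bounded_lattice Q" "\<bottom>\<^bsub>Q\<^esub> = Some zero" "\<top>\<^bsub>Q\<^esub> = None"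
  using zero_finsupp
  by (intro Q.bounded_latticeI[of "Some zero" None] Q.bottom_eq Q.top_eq;
      simp add: zero_le_Q; simp add: carrier_Q finsupp_def)+

lemma bounds_S: "bounded_lattice S" "\<bottom>\<^bsub>S\<^esub> = Some zero" "\<top>\<^bsub>S\<^esub> = None"
  using zero_finsupp
  by (intro S.bounded_latticeI[of "Some zero" None] S.bottom_eq S.top_eq;
      simp add: zero_le_S; simp add: carrier_S)+

lemma S_bounded_sublattice: "bounded_sublattice (carrier S) Q"
  unfolding bounded_sublattice_def bounds_Q
proof (intro conjI ballI)
  fix x y assume "x \<in> carrier S" "y \<in> carrier S"
  then show "x \<squnion>\<^bsub>Q\<^esub> y \<in> carrier S" "x \<sqinter>\<^bsub>Q\<^esub> y \<in> carrier S"
    using S_subset S_closed by (simp_all add: Q.join_eq Q.meet_eq subset_iff)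
qed (use zero_finsupp S_subset in \<open>auto simp: carrier_S\<close>)

text \<open>By the descending chain condition the values that members of the filter take at a fixed index
  have a least element.  Below one member \<open>x\<close> of the filter only the finitely many indices in the
  support of \<open>x\<close> matter, so the meet of \<open>x\<close> with finitely many members attains all these least values
  at once and generates the filter.\<close>

lemma Filt_S_principal:
  assumes F: "F \<in> Filt S"
  shows "\<exists>a\<in>carrier S. F = principal_filter S a"
proof -
  note FD = FiltD[OF F]
  have "\<exists>a\<in>F. \<forall>y\<in>F. a \<sqsubseteq>\<^bsub>S\<^esub> y"
  proof (cases "\<exists>x. Some x \<in> F")
    case False
    then have "F = {None}"
      using FD(1,2) by (auto simp: carrier_S)
    then show ?thesis
      by simp
  next
    case True
    then obtain x where x: "Some x \<in> F"
      by blast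
    have FFS: "z \<in> finsupp" if "Some z \<in> F" for z
      using that FD(1) by (auto simp: carrier_S)
    have meetF: "Some (pmeet y z) \<in> F" if "Some y \<in> F" "Some z \<in> F" for y z
      using FD(3)[OF that] meet_S[OF FFS FFS] that by simp
    have coord: "\<exists>y. Some y \<in> F \<and> (\<forall>z. Some z \<in> F \<longrightarrow> y i \<sqsubseteq>\<^bsub>A i\<^esub> z i)" if i: "i \<in> M" for i
    proof -
      let ?X = "{y i | y. Some y \<in> F}"
      have "\<exists>a\<in>?X. \<forall>b\<in>?X. a \<sqsubseteq>\<^bsub>A i\<^esub> b"
      proof (rule dcc_least[OF lattice_A[OF i] dcc_A[OF i]])
        show "?X \<subseteq> carrier (A i)"
          using FFS finsupp_mem i by blast
        show "?X \<noteq> {}"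
          using x by blast
      next
        fix a b assume "a \<in> ?X" "b \<in> ?X"
        then obtain y z where yz: "a = y i" "b = z i" "Some y \<in> F" "Some z \<in> F"
          by blast
        then have "a \<sqinter>\<^bsub>A i\<^esub> b = pmeet y z i"
          using i by (simp add: pmeet_def)
        then show "a \<sqinter>\<^bsub>A i\<^esub> b \<in> ?X"
          using meetF yz by blast
      qed
      then show ?thesis
        by blast
    qed
    have "\<exists>y. Some y \<in> F \<and> y \<sqsubseteq>\<^bsub>P\<^esub> x \<and> (\<forall>i\<in>T. \<forall>z. Some z \<in> F \<longrightarrow> y i \<sqsubseteq>\<^bsub>A i\<^esub> z i)"
      if "finite T" "T \<subseteq> M" for T
      using that
    proof (induction T)
      case empty
      have "x \<sqsubseteq>\<^bsub>P\<^esub> x"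
        using FFS[OF x] by (auto simp: finsupp_def intro: P.refl)
      with x show ?case
        by blast
    next
      case (insert k T)
      then obtain y where y: "Some y \<in> F" "y \<sqsubseteq>\<^bsub>P\<^esub> x"
          "\<And>i z. \<lbrakk>i \<in> T; Some z \<in> F\<rbrakk> \<Longrightarrow> y i \<sqsubseteq>\<^bsub>A i\<^esub> z i"
        by blast
      obtain w where w: "Some w \<in> F" "\<And>z. Some z \<in> F \<Longrightarrow> w k \<sqsubseteq>\<^bsub>A k\<^esub> z k"
        using coord insert.prems by blast
      \<comment> \<open>The meet with \<open>w\<close> is least at \<open>k\<close> and, being below \<open>y\<close>, stays least on \<open>T\<close>.\<close>
      have le: "pmeet y w i \<sqsubseteq>\<^bsub>A i\<^esub> y i" "pmeet y w i \<sqsubseteq>\<^bsub>A i\<^esub> w i" if "i \<in> M" for i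
        using that lattice_ops.m_left[OF ops_A] lattice_ops.m_right[OF ops_A]
          finsupp_mem[OF FFS[OF y(1)]] finsupp_mem[OF FFS[OF w(1)]]
        by (simp_all add: pmeet_def)
      have trans: "pmeet y w i \<sqsubseteq>\<^bsub>A i\<^esub> z i"
        if "i \<in> M" "v \<in> finsupp" "z \<in> finsupp" "pmeet y w i \<sqsubseteq>\<^bsub>A i\<^esub> v i" "v i \<sqsubseteq>\<^bsub>A i\<^esub> z i" for i v z
        using that finsupp_mem pmeet_finsupp[OF FFS[OF y(1)] FFS[OF w(1)]]
        by (intro lattice_ops.trans[OF ops_A[of i], of "pmeet y w i" "v i" "z i"]) auto
      have "pmeet y w \<sqsubseteq>\<^bsub>P\<^esub> x"
        unfolding le_P using trans[OF _ FFS[OF y(1)] FFS[OF x] le(1)] y(2) by (simp add: le_P)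
      moreover have "pmeet y w i \<sqsubseteq>\<^bsub>A i\<^esub> z i" if "i \<in> insert k T" "Some z \<in> F" for i z
      proof (cases "i = k")
        case True
        then show ?thesis
          using trans[OF _ FFS[OF w(1)] FFS le(2)] w(2) that insert.prems by blast
      next
        case False
        then show ?thesis
          using trans[OF _ FFS[OF y(1)] FFS le(1)] y(3) that insert.prems by blast
      qed
      ultimately show ?case
        using meetF[OF y(1) w(1)] by blast
    qed
    then obtain y where y: "Some y \<in> F" "y \<sqsubseteq>\<^bsub>P\<^esub> x"
        "\<And>i z. \<lbrakk>i \<in> supp x; Some z \<in> F\<rbrakk> \<Longrightarrow> y i \<sqsubseteq>\<^bsub>A i\<^esub> z i"
      using FFS[OF x] by (metis (no_types, lifting) finsupp_def mem_Collect_eq supp_def subsetI)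
    have "y \<sqsubseteq>\<^bsub>P\<^esub> z" if z: "Some z \<in> F" for z
      unfolding le_P
    proof
      fix i assume i: "i \<in> M"
      show "y i \<sqsubseteq>\<^bsub>A i\<^esub> z i"
      proof (cases "i \<in> supp x")
        case False
        then have "y i = \<bottom>\<^bsub>A i\<^esub>"
          using supp_mono[OF FFS[OF y(1)] y(2)] finsupp_outside i by blast
        then show ?thesis
          using bottom_A_le[OF i finsupp_mem[OF FFS[OF z] i]] by simp
      qed (use y(3) z in blast)
    qed
    then have "Some y \<sqsubseteq>\<^bsub>S\<^esub> u" if "u \<in> F" for u
      using that by (cases u) auto
    with y(1) show ?thesis
      by blast
  qed
  then obtain a where a: "a \<in> F" "\<And>y. y \<in> F \<Longrightarrow> a \<sqsubseteq>\<^bsub>S\<^esub> y"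
    by blast
  have "F = principal_filter S a"
    unfolding principal_filter_def using a FD(1,4) by blast
  with a(1) FD(1) show ?thesis
    by blast
qed

lemma pjoin_single: "i \<in> M \<Longrightarrow> a \<in> carrier (A i) \<Longrightarrow> b \<in> carrier (A i) \<Longrightarrow>
    pjoin (single i a) (single i b) = single i (a \<squnion>\<^bsub>A i\<^esub> b)"
  and pmeet_single: "i \<in> M \<Longrightarrow> a \<in> carrier (A i) \<Longrightarrow> b \<in> carrier (A i) \<Longrightarrow>
    pmeet (single i a) (single i b) = single i (a \<sqinter>\<^bsub>A i\<^esub> b)"
  by (auto simp: pjoin_def pmeet_def single_def bottom_A_simps bottom_A)

text \<open>Meeting with a large enough element of the axis is the projection to that axis.\<close>

lemma pmeet_single_le:
  assumes "i \<in> M" "x \<in> finsupp" "a \<in> carrier (A i)" "x i \<sqsubseteq>\<^bsub>A i\<^esub> a"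
  shows "pmeet x (single i a) = single i (x i)"
proof -
  have "x i \<sqinter>\<^bsub>A i\<^esub> a = x i"
    using assms lattice_ops.le_iff_m[OF ops_A] finsupp_mem by blast
  then show ?thesis
    using assms finsupp_mem by (auto simp: pmeet_def single_def bottom_A_simps)
qed

text \<open>Along the embedding of \<open>A i\<close> as the \<open>i\<close>-th axis, a congruence in \<^term>\<open>Con01 S\<close> pulls back to one
  with singleton class at the bottom, hence to equality.  Meeting two related families with an
  element of the axis extracts their \<open>i\<close>-th components.\<close>

lemma Con01_S:
  assumes con: "\<And>i. i \<in> M \<Longrightarrow>
      {\<alpha> \<in> Con (A i). \<alpha> `` {\<bottom>\<^bsub>A i\<^esub>} = {\<bottom>\<^bsub>A i\<^esub>}} = {Id_on (carrier (A i))}"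
  shows "Con01 S = {Id_on (carrier S)}"
proof -
  have "\<theta> = Id_on (carrier S)" if \<theta>: "\<theta> \<in> Con01 S" for \<theta>
  proof -
    have \<theta>C: "\<theta> \<in> Con S" and bot: "\<theta> `` {Some zero} = {Some zero}" and top: "\<theta> `` {None} = {None}"
      using \<theta> by (auto simp: Con01_def bounds_S)
    note C = ConD[OF \<theta>C]
    have J: "(Some (pjoin x y), Some (pjoin x' y')) \<in> \<theta>"
      and Mt: "(Some (pmeet x y), Some (pmeet x' y')) \<in> \<theta>"
      if "(Some x, Some x') \<in> \<theta>" "(Some y, Some y') \<in> \<theta>" for x y x' y'
      using S.Con_j[OF \<theta>C that] S.Con_m[OF \<theta>C that] by (simp_all add: top_join_def top_meet_def)
    define \<alpha> where "\<alpha> i = {(a, b). a \<in> carrier (A i) \<and> b \<in> carrier (A i) \<and>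
        (Some (single i a), Some (single i b)) \<in> \<theta>}" for i
    have axis: "\<alpha> i = Id_on (carrier (A i))" if i: "i \<in> M" for i
    proof -
      interpret Ai: lattice_ops "A i" "join (A i)" "meet (A i)"
        by (rule ops_A) (rule i)
      have "equiv (carrier (A i)) (\<alpha> i)"
      proof (rule equivI)
        show "\<alpha> i \<subseteq> carrier (A i) \<times> carrier (A i)"
          by (auto simp: \<alpha>_def)
        show "refl_on (carrier (A i)) (\<alpha> i)"
          using C(2) single_finsupp[OF i] by (simp add: refl_on_def \<alpha>_def carrier_S)
        show "sym (\<alpha> i)"
          using C(3) by (simp add: sym_def \<alpha>_def)
        show "trans (\<alpha> i)"
          using C(4) unfolding trans_def \<alpha>_def by blast
      qed
      moreover have "(a \<squnion>\<^bsub>A i\<^esub> b, a' \<squnion>\<^bsub>A i\<^esub> b') \<in> \<alpha> i \<and> (a \<sqinter>\<^bsub>A i\<^esub> b, a' \<sqinter>\<^bsub>A i\<^esub> b') \<in> \<alpha> i"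
        if "(a, a') \<in> \<alpha> i" "(b, b') \<in> \<alpha> i" for a a' b b'
        using that J[of "single i a" "single i a'" "single i b" "single i b'"]
          Mt[of "single i a" "single i a'" "single i b" "single i b'"] i
        by (simp add: \<alpha>_def pjoin_single pmeet_single Ai.j_closed Ai.m_closed)
      ultimately have "\<alpha> i \<in> Con (A i)"
        unfolding Ai.Con_iff by blast
      moreover have "\<alpha> i `` {\<bottom>\<^bsub>A i\<^esub>} = {\<bottom>\<^bsub>A i\<^esub>}"
      proof -
        have z: "single i \<bottom>\<^bsub>A i\<^esub> = zero"
          by (auto simp: single_def zero_def)
        have "a = \<bottom>\<^bsub>A i\<^esub>" if "(\<bottom>\<^bsub>A i\<^esub>, a) \<in> \<alpha> i" for a
        proof -
          have "single i a = zero"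
            using that bot z by (auto simp: \<alpha>_def)
          then have "single i a i = zero i"
            by simp
          then show ?thesis
            using i by (simp add: single_def zero_def)
        qed
        moreover have "(\<bottom>\<^bsub>A i\<^esub>, \<bottom>\<^bsub>A i\<^esub>) \<in> \<alpha> i"
          using i C(2) zero_finsupp by (simp add: \<alpha>_def z bottom_A carrier_S)
        ultimately show ?thesis
          by blast
      qed
      ultimately show ?thesis
        using con[OF i] by blast
    qed
    have None: "v = None" if "(None, v) \<in> \<theta>" for v
      using that top by blast
    have Some: "x = y" if xy: "(Some x, Some y) \<in> \<theta>" for x y
    proof (rule finsupp_ext)
      show fs: "x \<in> finsupp" "y \<in> finsupp"
        using xy C(1) by (auto simp: carrier_S)
      fix i assume i: "i \<in> M"
      interpret Ai: lattice_ops "A i" "join (A i)" "meet (A i)"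
        by (rule ops_A) (rule i)
      \<comment> \<open>A point of the axis above both components, so that meeting with it loses nothing.\<close>
      let ?a = "x i \<squnion>\<^bsub>A i\<^esub> y i"
      have c: "x i \<in> carrier (A i)" "y i \<in> carrier (A i)"
        using fs i finsupp_mem by auto
      have "Some (single i ?a) \<in> carrier S"
        using single_finsupp[OF i Ai.j_closed[OF c]] by (simp add: carrier_S)
      then have "(Some (pmeet x (single i ?a)), Some (pmeet y (single i ?a))) \<in> \<theta>"
        by (intro Mt xy C(2))
      then have "(Some (single i (x i)), Some (single i (y i))) \<in> \<theta>"
        using pmeet_single_le[OF i fs(1) Ai.j_closed[OF c] Ai.j_left[OF c]]
          pmeet_single_le[OF i fs(2) Ai.j_closed[OF c] Ai.j_right[OF c]] by simp
      then have "(x i, y i) \<in> \<alpha> i"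
        using c by (simp add: \<alpha>_def)
      then show "x i = y i"
        by (simp add: axis[OF i] Id_on_iff)
    qed
    have "u = v" if "(u, v) \<in> \<theta>" for u v
      using that C(3)[OF that] None Some by (cases u; cases v) metis+
    then show ?thesis
      using C(1,2) by auto
  qed
  moreover have "Id_on (carrier S) \<in> Con01 S"
    using S.Id_on_Con zero_finsupp by (auto simp: Con01_def bounds_S carrier_S)
  ultimately show ?thesis
    by blast
qed

section \<open>Cardinalities\<close>

definition nontriv :: "'i set" where
  "nontriv = {i \<in> M. \<exists>x\<in>carrier (A i). \<exists>y\<in>carrier (A i). x \<noteq> y}"

definition witness :: "'i \<Rightarrow> 'a" where
  "witness i = (SOME a. a \<in> carrier (A i) \<and> a \<noteq> \<bottom>\<^bsub>A i\<^esub>)"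

definition spike :: "'i \<Rightarrow> 'i \<Rightarrow> 'a" where
  "spike i = single i (witness i)"

lemma witness:
  assumes "i \<in> nontriv"
  shows "witness i \<in> carrier (A i)" "witness i \<noteq> \<bottom>\<^bsub>A i\<^esub>"
proof -
  have "\<exists>a. a \<in> carrier (A i) \<and> a \<noteq> \<bottom>\<^bsub>A i\<^esub>"
    using assms by (auto simp: nontriv_def)
  then show "witness i \<in> carrier (A i)" "witness i \<noteq> \<bottom>\<^bsub>A i\<^esub>"
    unfolding witness_def by (metis (mono_tags, lifting) someI_ex)+
qed

lemma spike_finsupp: "i \<in> nontriv \<Longrightarrow> spike i \<in> finsupp"
  unfolding spike_def by (rule single_finsupp) (auto simp: nontriv_def witness)

lemma supp_spike: "i \<in> nontriv \<Longrightarrow> supp (spike i) = {i}"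
  using witness by (auto simp: spike_def supp_def single_def nontriv_def split: if_splits)

text \<open>A finitely supported family is coded by the graph of its restriction to its support, a finite
  subset of the disjoint union of the factors.\<close>

lemma card_finsupp_le:
  assumes inf: "infinite M" and le: "\<And>i. i \<in> M \<Longrightarrow> |carrier (A i)| \<le>o |M|"
  shows "|finsupp| \<le>o |M|"
proof -
  let ?B = "SIGMA i:M. carrier (A i)"
  define graph where "graph x = (\<lambda>i. (i, x i)) ` supp x" for x
  have "x = y" if xy: "x \<in> finsupp" "y \<in> finsupp" "graph x = graph y" for x y
  proof (rule finsupp_ext[OF xy(1,2)])
    fix i assume i: "i \<in> M"
    have "x i = y i" if "i \<in> supp x"
    proof -
      have "(i, x i) \<in> graph y"
        using that unfolding xy(3)[symmetric] by (simp add: graph_def)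
      then show ?thesis
        by (auto simp: graph_def)
    qed
    moreover have "x i = y i" if "i \<in> supp y"
    proof -
      have "(i, y i) \<in> graph x"
        using that unfolding xy(3) by (simp add: graph_def)
      then show ?thesis
        by (auto simp: graph_def)
    qed
    ultimately show "x i = y i"
      using finsupp_outside[OF i] by metis
  qed
  then have "inj_on graph finsupp"
    by (rule inj_onI)
  moreover have "graph ` finsupp \<subseteq> Fpow ?B"
    using finsupp_mem by (auto simp: graph_def Fpow_def finsupp_def supp_def)
  ultimately have "|finsupp| \<le>o |Fpow ?B|"
    using card_of_ordLeq by blast
  moreover have "infinite ?B"
  proof
    assume "finite ?B"
    moreover have "fst ` ?B = M"
      using nonempty_A by force
    ultimately show False
      using inf finite_imageI by metis
  qed
  then have "|Fpow ?B| =o |?B|"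
    by (rule card_of_Fpow_infinite)
  moreover have "|?B| \<le>o |M|"
    using le by (intro card_of_Sigma_ordLeq_infinite[OF inf]) auto
  ultimately show ?thesis
    using ordLeq_ordIso_trans ordLeq_transitive by blast
qed

lemma card_S:
  assumes inf: "infinite M" and le: "\<And>i. i \<in> M \<Longrightarrow> |carrier (A i)| \<le>o |M|"
    and nontriv: "|nontriv| =o |M|"
  shows "|carrier S| =o |M|"
proof -
  have "|Some ` finsupp| \<le>o |M|"
    using card_finsupp_le[OF inf le] card_of_image ordLeq_transitive by blast
  moreover have "|{None :: ('i \<Rightarrow> 'a) option}| \<le>o |M|"
    using inf by (intro ordLess_imp_ordLeq finite_ordLess_infinite2) auto
  ultimately have "|{None} \<union> Some ` finsupp| \<le>o |M|"
    using card_of_Un_ordLeq_infinite[OF inf] by blast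
  then have "|carrier S| \<le>o |M|"
    by (simp add: carrier_S)
  moreover have "|nontriv| \<le>o |carrier S|"
  proof (rule card_of_ordLeqI[of "\<lambda>i. Some (spike i)"])
    show "inj_on (\<lambda>i. Some (spike i)) nontriv"
      using supp_spike by (intro inj_onI) (metis option.inject singleton_inject)
  qed (simp add: carrier_S spike_finsupp)
  then have "|M| \<le>o |carrier S|"
    using nontriv ordIso_symmetric ordIso_ordLeq_trans by blast
  ultimately show ?thesis
    by (simp add: ordIso_iff_ordLeq)
qed

text \<open>Every set \<open>X\<close> of indices with nontrivial factors yields the ideal of the families supported in
  \<open>X\<close>; the spikes that it contains give \<open>X\<close> back.\<close>

lemma card_Idl_S:
  assumes inf: "infinite M" and le: "\<And>i. i \<in> M \<Longrightarrow> |carrier (A i)| \<le>o |M|"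
    and nontriv: "|nontriv| =o |M|"
  shows "|Idl S| =o |Pow M|"
proof -
  define I where "I X = Some ` {x \<in> finsupp. supp x \<subseteq> X}" for X
  have I_iff: "u \<in> I X \<longleftrightarrow> (\<exists>x. u = Some x \<and> x \<in> finsupp \<and> supp x \<subseteq> X)" for u X
    by (auto simp: I_def)
  have Idl: "I X \<in> Idl S" for X
  proof -
    have "I X \<subseteq> carrier S"
      by (auto simp: I_def carrier_S)
    moreover have "Some zero \<in> I X"
      using zero_finsupp supp_zero by (simp add: I_def)
    moreover have "u \<squnion>\<^bsub>S\<^esub> v \<in> I X" if uv: "u \<in> I X" "v \<in> I X" for u v
    proof -
      obtain x y where "u = Some x" "v = Some y" "x \<in> finsupp" "y \<in> finsupp" "supp x \<union> supp y \<subseteq> X"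
        using uv by (auto simp: I_iff)
      then show ?thesis
        using supp_pjoin[of x y] by (simp add: I_iff join_S pjoin_finsupp) blast
    qed
    moreover have "v \<in> I X" if uv: "u \<in> I X" "v \<in> carrier S" "v \<sqsubseteq>\<^bsub>S\<^esub> u" for u v
    proof -
      obtain x y where "u = Some x" "v = Some y" "y \<in> finsupp" "supp x \<subseteq> X" "y \<sqsubseteq>\<^bsub>P\<^esub> x"
        using uv by (auto simp: I_iff carrier_S)
      then show ?thesis
        using supp_mono[of y x] by (auto simp: I_iff)
    qed
    ultimately show ?thesis
      unfolding Idl_def by blast
  qed
  have spike_I: "Some (spike i) \<in> I X \<longleftrightarrow> i \<in> X" if "i \<in> nontriv" for i X
    using that spike_finsupp supp_spike by (simp add: I_iff)
  have "{i \<in> nontriv. Some (spike i) \<in> I X} = X" if "X \<in> Pow nontriv" for X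
    using that by (auto simp: spike_I)
  then have "inj_on I (Pow nontriv)"
    by (rule inj_on_inverseI[where g = "\<lambda>K. {i \<in> nontriv. Some (spike i) \<in> K}"])
  then have "|Pow nontriv| \<le>o |Idl S|"
    by (rule card_of_ordLeqI) (rule Idl)
  moreover have "|Pow M| =o |Pow nontriv|"
    by (rule card_of_Pow_cong) (rule ordIso_symmetric[OF nontriv])
  ultimately have "|Pow M| \<le>o |Idl S|"
    by (metis ordIso_ordLeq_trans)
  moreover have "|Idl S| \<le>o |Pow M|"
    using card_Idl_le card_of_Pow_cong[OF card_S[OF inf le nontriv]] by (rule ordLeq_ordIso_trans)
  ultimately show ?thesis
    by (simp add: ordIso_iff_ordLeq)
qed

end

theorem mainTheorem4:
  fixes \<kappa> :: "'k rel" and M :: "'i set" and A :: "'i \<Rightarrow> 'a gorder"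
    and P :: "('i \<Rightarrow> 'a) gorder"
    and Q S :: "('i \<Rightarrow> 'a) option gorder"
    and H :: "(('i \<Rightarrow> 'a) option + bool \<times> bool) gorder"
  assumes kappa: "Card_order \<kappa>" "infinite (Field \<kappa>)"
    and M: "|M| =o \<kappa>"
    and lat: "\<And>i. i \<in> M \<Longrightarrow> lattice (A i)"
    and nonempty: "\<And>i. i \<in> M \<Longrightarrow> carrier (A i) \<noteq> {}"
    and nontrivial: "|{i \<in> M. \<exists>x\<in>carrier (A i). \<exists>y\<in>carrier (A i). x \<noteq> y}| =o \<kappa>"
    and dcc: "\<And>i. i \<in> M \<Longrightarrow> dcc (A i)"
    and card_le: "\<And>i. i \<in> M \<Longrightarrow> |carrier (A i)| \<le>o \<kappa>"
    and con: "\<And>i. i \<in> M \<Longrightarrow>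
      {\<alpha> \<in> Con (A i). \<alpha> `` {\<bottom>\<^bsub>A i\<^esub>} = {\<bottom>\<^bsub>A i\<^esub>}} = {Id_on (carrier (A i))}"
    and P_def: "P = prod_lattice M A"
    and Q_def: "Q = add_top P"
    and S_def: "S = Q\<lparr>carrier :=
      insert None (Some ` {x \<in> carrier P. finite {i \<in> M. x i \<noteq> \<bottom>\<^bsub>A i\<^esub>}})\<rparr>"
    and H_def: "H = S \<boxplus> L22"
  shows "bounded_lattice Q \<and> bounded_sublattice (carrier S) Q \<and> bounded_lattice S \<and>
    |carrier S| =o \<kappa> \<and>
    (\<forall>F\<in>Filt S. \<exists>a\<in>carrier S. F = principal_filter S a) \<and>
    |Filt S| =o \<kappa> \<and>
    |Idl S| =o ctwo ^c \<kappa> \<and>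
    Con01 S = {Id_on (carrier S)} \<and>
    bounded_lattice H \<and> simple_lattice H \<and>
    |Filt H| =o |Filt S| \<and> |Filt H| =o \<kappa> \<and>
    |Idl H| =o |Idl S| \<and> |Idl H| =o ctwo ^c \<kappa> \<and>
    \<not> |Con H| =o |Filt H| \<and> \<not> |Con H| =o |Idl H| \<and> \<not> |Filt H| =o |Idl H|"
proof -
  interpret F: lattice_family M A
    by (rule lattice_family.intro) (fact lat dcc nonempty)+
  have S: "S = F.S"
    by (simp add: S_def Q_def P_def F.S_def F.finsupp_def F.supp_def)
  have Q: "Q = F.Q"
    by (simp add: Q_def P_def)
  have inf: "infinite M"
    using card_of_ordIso_finite_Field[OF kappa(1) ordIso_symmetric[OF M]] kappa(2) by blast
  have le: "|carrier (A i)| \<le>o |M|" if "i \<in> M" for i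
    using card_le[OF that] ordIso_symmetric[OF M] by (rule ordLeq_ordIso_trans)
  have N: "|F.nontriv| =o |M|"
    using nontrivial ordIso_symmetric[OF M] unfolding F.nontriv_def by (rule ordIso_transitive)
  have Pow: "|Pow M| =o ctwo ^c \<kappa>"
    using Pow_cexp_ctwo cexp_cong2[OF M Card_order_ctwo card_of_Card_order]
    by (rule ordIso_transitive)
  have carrier_S: "|carrier F.S| =o \<kappa>"
    using F.card_S[OF inf le N] M by (rule ordIso_transitive)
  have principal: "\<forall>G\<in>Filt F.S. \<exists>a\<in>carrier F.S. G = principal_filter F.S a"
    using F.Filt_S_principal by blast
  have Filt_S: "|Filt F.S| =o \<kappa>"
    using card_Filt_if_all_principal[OF F.S.lattice principal] carrier_S by (rule ordIso_transitive)
  have Idl_S: "|Idl F.S| =o ctwo ^c \<kappa>"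
    using F.card_Idl_S[OF inf le N] Pow by (rule ordIso_transitive)
  have Con01_S: "Con01 F.S = {Id_on (carrier F.S)}"
    by (rule F.Con01_S) (rule con)

  have "infinite F.nontriv"
    using card_of_ordIso_finite[OF N] inf by blast
  then obtain i where i: "i \<in> F.nontriv"
    using infinite_imp_nonempty by blast
  have spike: "Some (F.spike i) \<in> carrier F.S" "Some (F.spike i) \<noteq> \<bottom>\<^bsub>F.S\<^esub>" "Some (F.spike i) \<noteq> \<top>\<^bsub>F.S\<^esub>"
    using F.spike_finsupp[OF i] F.supp_spike[OF i] F.supp_zero by (auto simp: F.carrier_S F.bounds_S)
  interpret bounded_lattice F.S
    by (rule F.bounds_S)
  interpret G: hsum_L22 F.S
    by unfold_locales (simp add: F.bounds_S)
  have H: "H = F.S \<boxplus> L22"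
    by (simp add: H_def S)
  have simple: "simple_lattice H"
    unfolding H by (rule G.simple_H[OF Con01_S spike])
  have inf_Filt: "infinite (Filt F.S)"
    using card_of_ordIso_finite_Field[OF kappa(1) ordIso_symmetric[OF Filt_S]] kappa(2) by blast
  have less: "|Filt F.S| <o |Idl F.S|"
  proof -
    have "|Filt F.S| =o |M|"
      using Filt_S ordIso_symmetric[OF M] by (rule ordIso_transitive)
    then show ?thesis
      using card_of_Pow ordIso_symmetric[OF F.card_Idl_S[OF inf le N]]
        ordIso_ordLess_trans ordLess_ordIso_trans by blast
  qed
  then have inf_Idl: "infinite (Idl F.S)"
    using inf_Filt card_of_ordLeq_infinite ordLess_imp_ordLeq by blast
  have Filt_H: "|Filt H| =o |Filt F.S|"
    unfolding H by (rule G.card_Filt_H[OF inf_Filt])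
  have Idl_H: "|Idl H| =o |Idl F.S|"
    unfolding H by (rule G.card_Idl_H[OF inf_Idl])
  have fin_Con: "finite (Con H)"
    using simple by (intro card_ge_0_finite) (simp add: simple_lattice_def)
  have "infinite (Filt H)" "infinite (Idl H)"
    using inf_Filt inf_Idl card_of_ordIso_finite[OF Filt_H] card_of_ordIso_finite[OF Idl_H]
    by simp_all
  then have "\<not> |Con H| =o |Filt H|" "\<not> |Con H| =o |Idl H|"
    using fin_Con by (auto dest: card_of_ordIso_finite)
  moreover have "\<not> |Filt H| =o |Idl H|"
  proof
    assume "|Filt H| =o |Idl H|"
    then have "|Filt F.S| =o |Idl F.S|"
      by (rule ordIso_transitive[OF ordIso_symmetric[OF Filt_H] ordIso_transitive[OF _ Idl_H]])
    then show False
      using not_ordLess_ordIso[OF less] by contradiction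
  qed
  moreover have "|Filt H| =o \<kappa>" "|Idl H| =o ctwo ^c \<kappa>"
    by (rule ordIso_transitive[OF Filt_H Filt_S], rule ordIso_transitive[OF Idl_H Idl_S])
  ultimately show ?thesis
    using F.bounds_Q(1) F.S_bounded_sublattice F.bounds_S(1) carrier_S principal Filt_S Idl_S Con01_S
      G.H_bounded simple Filt_H Idl_H
    unfolding S Q H by (intro conjI)
qed

end
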